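(* Let $G$ be a minimal $3$-factor-critical planar graph. Then $\delta(G)=4$.
   Context: All graphs are simple and finite. A graph $G$ of order $n$ is $3$-factor-critical (with $3<n$) if for every set $S$ of $3$ vertices, $G-S$ has a perfect matching. A $3$-factor-critical graph $G$ is minimal if $G-e$ is not $3$-factor-critical for every edge $e$ of $G$. $\delta(G)$ is the minimum degree of $G$. *)

theory Defs
  imports "HOL-Analysis.Analysis"
begin

text \<open>A graph is given by its vertex set \<open>V\<close> and its edge set \<open>E\<close>; an edge is the
  two-element set of its endpoints.\<close>

definition simple_graph :: "'a set \<Rightarrow> 'a set set \<Rightarrow> bool" where
  "simple_graph V E \<longleftrightarrow> finite V \<and> (\<forall>e\<in>E. e \<subseteq> V \<and> card e = 2)"

definition degree :: "'a set set \<Rightarrow> 'a \<Rightarrow> nat" where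
  "degree E v = card {e \<in> E. v \<in> e}"

text \<open>Only meaningful for nonempty \<open>V\<close>, as \<open>Min {}\<close> is unspecified.\<close>

definition min_degree :: "'a set \<Rightarrow> 'a set set \<Rightarrow> nat" where
  "min_degree V E = Min (degree E ` V)"

definition perfect_matching :: "'a set \<Rightarrow> 'a set set \<Rightarrow> 'a set set \<Rightarrow> bool" where
  "perfect_matching V E M \<longleftrightarrow> M \<subseteq> E \<and> (\<forall>v\<in>V. \<exists>!e. e \<in> M \<and> v \<in> e)"

text \<open>\<open>G - S\<close> has vertex set \<open>V - S\<close> and keeps the edges that avoid \<open>S\<close>.\<close>

definition factor_critical :: "nat \<Rightarrow> 'a set \<Rightarrow> 'a set set \<Rightarrow> bool" where
  "factor_critical k V E \<longleftrightarrow>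
     k < card V \<and>
     (\<forall>S. S \<subseteq> V \<and> card S = k \<longrightarrow>
        (\<exists>M. perfect_matching (V - S) {e \<in> E. e \<inter> S = {}} M))"

definition minimal_factor_critical :: "nat \<Rightarrow> 'a set \<Rightarrow> 'a set set \<Rightarrow> bool" where
  "minimal_factor_critical k V E \<longleftrightarrow>
     factor_critical k V E \<and> (\<forall>e\<in>E. \<not> factor_critical k V (E - {e}))"

text \<open>A drawing in the plane without crossings: \<open>p\<close> places the vertices at distinct points and
  \<open>g e\<close> is a simple arc joining the endpoints of \<open>e\<close>.  An arc contains no vertices other than its
  endpoints, and two distinct arcs can meet only in the image of a common endpoint.\<close>

definition plane_drawing ::
  "'a set \<Rightarrow> 'a set set \<Rightarrow> ('a \<Rightarrow> complex) \<Rightarrow> ('a set \<Rightarrow> real \<Rightarrow> complex) \<Rightarrow> bool" where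
  "plane_drawing V E p g \<longleftrightarrow>
     inj_on p V \<and>
     (\<forall>e\<in>E. arc (g e) \<and> {pathstart (g e), pathfinish (g e)} = p ` e \<and>
             path_image (g e) \<inter> p ` V = p ` e) \<and>
     (\<forall>e\<in>E. \<forall>f\<in>E. e \<noteq> f \<longrightarrow> path_image (g e) \<inter> path_image (g f) \<subseteq> p ` (e \<inter> f))"

definition planar :: "'a set \<Rightarrow> 'a set set \<Rightarrow> bool" where
  "planar V E \<longleftrightarrow> (\<exists>p g. plane_drawing V E p g)"

end

theory Submission
  imports Defs
begin

text \<open>Assume that all degrees are at least 5. By minimality and Tutte's theorem every edge \<open>e\<close> has a
  barrier \<open>T\<close>: the graph \<open>G - e - T\<close> has at least \<open>|T| - 1\<close> odd components. An odd component has at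
  least four neighbours in \<open>G\<close>, while contracting the components gives a bipartite planar graph, which
  has at most \<open>2n - 4\<close> edges. The two counts agree, so there are exactly \<open>|T| - 1\<close> components, and each
  is odd and has exactly four neighbours.

  Now let \<open>C\<close> be a smallest odd vertex set with four neighbours and choose \<open>e\<close> inside \<open>C\<close>. Submodularity
  of the neighbourhood size shows that every component of \<open>G - e - T\<close> meets \<open>C\<close> in an even number of
  vertices, so \<open>T\<close> meets \<open>C\<close> in an odd number. A second application of the planar count to \<open>T \<inter> C\<close> leaves
  only \<open>|T| = 3\<close> with \<open>|T \<inter> C| = 1\<close>, and this configuration contains a K(3,3) minor when \<open>e\<close> is chosen
  with some care.

  The planar count is topological: Janiszewski's theorem controls how the components of the complement
  of a plane graph change when an arc is added.\<close>

section \<open>Reachability and forests\<close>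

text \<open>With t = |T|, the t - 1 odd components have at least 4(t - 1) neighbours in all, and
  only the two ends of e can be neighbours outside T. So there are at least 4t - 6 contacts with T,
  which is exactly 2n - 4 for n = t + (t - 1). Since nothing may be lost, e joins two different
  components, and each of these has three of its four neighbours in T. The degree assumption
  supplies the edge e: a vertex of C has at most four neighbours outside C, hence one inside. Its
  end x is taken next to a vertex b of the neighbourhood A of C. In the last configuration two
  vertices of A lie in T, and ax, ay lie one in each component. Both components extend beyond C and
  A, so A - {ax} and A - {ay} are neighbourhoods of connected sets there. If b is chosen, whenever
  possible, such that A - {b} is a neighbourhood of this kind, then b is ax or ay. As x cannot be
  adjacent to ay in the other component, b = ax, and the edge from x to ax completes the
  K(3,3).\<close>

definition reach :: "'a set set \<Rightarrow> 'a \<Rightarrow> 'a \<Rightarrow> bool" where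
  "reach X = (\<lambda>u v. {u, v} \<in> X)\<^sup>*\<^sup>*"

text \<open>Acyclicity in the form "every edge is a bridge", so that cycles never have to be handled
  as objects and edges can be added or removed one at a time.\<close>

definition forest :: "'a set set \<Rightarrow> bool" where
  "forest X \<longleftrightarrow> (\<forall>u v. {u, v} \<in> X \<longrightarrow> \<not> reach (X - {{u, v}}) u v)"

lemma reach_refl [simp, intro]: "reach X u u"
  by (simp add: reach_def)

lemma reach_edge: "{u, v} \<in> X \<Longrightarrow> reach X u v"
  by (auto simp: reach_def)

lemma reach_trans [trans]: "reach X u v \<Longrightarrow> reach X v w \<Longrightarrow> reach X u w"
  unfolding reach_def by (rule rtranclp_trans)

lemma reach_sym: "reach X u v \<longleftrightarrow> reach X v u"
proof -
  have "symp (\<lambda>u v. {u, v} \<in> X)"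
    by (simp add: symp_def insert_commute)
  then show ?thesis
    unfolding reach_def by (meson symp_rtranclp sympD)
qed

lemma reach_mono: "reach X u v \<Longrightarrow> X \<subseteq> Y \<Longrightarrow> reach Y u v"
  unfolding reach_def by (erule rtranclp_mono[THEN predicate2D, rotated]) auto

lemma reach_subst:
  assumes "reach X u v" and "\<And>a b. {a, b} \<in> X \<Longrightarrow> reach Y a b"
  shows "reach Y u v"
  using assms(1) unfolding reach_def[of X]
  by (induction rule: rtranclp_induct) (auto intro: reach_trans assms(2))

lemma reach_closed:
  assumes "reach X u v" and "\<And>a b. {a, b} \<in> X \<Longrightarrow> a \<in> U \<Longrightarrow> b \<in> U" and "u \<in> U"
  shows "v \<in> U"
  using assms(1) unfolding reach_def
  by (induction rule: rtranclp_induct) (auto intro: assms)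

lemma reach_empty [simp]: "reach {} u v \<longleftrightarrow> u = v"
  using reach_closed[of "{}" u v "{u}"] by auto

lemma reach_insert:
  assumes "reach (insert {a, b} X) u v"
  shows "reach X u v \<or> reach X u a \<and> reach X b v \<or> reach X u b \<and> reach X a v"
  using assms unfolding reach_def[of "insert _ _"]
proof (induction rule: rtranclp_induct)
  case (step y z)
  from step.hyps(2) consider "{y, z} \<in> X" | "y = a" "z = b" | "y = b" "z = a"
    by (auto simp: doubleton_eq_iff)
  then show ?case
  proof cases
    case 1
    then show ?thesis using step.IH reach_edge reach_trans by metis
  qed (use step.IH in \<open>auto intro: reach_trans\<close>)
qed auto

lemma forest_empty [simp]: "forest {}"
  by (simp add: forest_def)

lemma forest_subset: "forest X \<Longrightarrow> Y \<subseteq> X \<Longrightarrow> forest Y"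
  unfolding forest_def by (meson Diff_mono reach_mono subset_iff order_refl)

text \<open>If some old edge {u, v} could be bypassed after the insertion, the bypass would run
  through {a, b}. Its two remaining pieces together with {u, v} would then already connect a and b
  in \<open>X\<close>.\<close>

lemma forest_insert:
  assumes X: "forest X" and ab: "\<not> reach X a b"
  shows "forest (insert {a, b} X)"
  unfolding forest_def
proof (intro allI impI notI)
  fix u v
  assume uv: "{u, v} \<in> insert {a, b} X" and r: "reach (insert {a, b} X - {{u, v}}) u v"
  have nX: "{a, b} \<notin> X"
    using ab reach_edge by metis
  show False
  proof (cases "{u, v} = {a, b}")
    case True
    then have "reach X u v" using r nX by simp
    with True ab show False
      by (auto simp: doubleton_eq_iff reach_sym)
  next
    case False
    then have uvX: "{u, v} \<in> X" using uv by simp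
    let ?Y = "X - {{u, v}}"
    have eq: "insert {a, b} X - {{u, v}} = insert {a, b} ?Y"
      using False by auto
    have "\<not> reach ?Y u v" using X uvX by (auto simp: forest_def)
    with reach_insert[OF r[unfolded eq]]
    have "reach ?Y u a \<and> reach ?Y b v \<or> reach ?Y u b \<and> reach ?Y a v" by simp
    then have "reach X u a \<and> reach X b v \<or> reach X u b \<and> reach X a v"
      by (meson Diff_subset reach_mono)
    then have "reach X a b"
      using reach_edge[OF uvX] reach_sym reach_trans by metis
    with ab show False ..
  qed
qed

definition reach_class :: "'a set \<Rightarrow> 'a set set \<Rightarrow> 'a \<Rightarrow> 'a set" where
  "reach_class V X u = {v \<in> V. reach X u v}"

lemma reach_class_eq_iff:
  assumes "u \<in> V" "v \<in> V"
  shows "reach_class V X u = reach_class V X v \<longleftrightarrow> reach X u v"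
  using assms by (auto simp: reach_class_def set_eq_iff) (metis reach_sym reach_trans reach_refl)+

text \<open>Every edge of a forest is a bridge, so inserting it merges exactly two classes: one more
  edge, one class less.\<close>

lemma forest_card:
  assumes "simple_graph V X" "forest X"
  shows "card X + card (reach_class V X ` V) = card V"
proof -
  have "finite X"
    using assms(1) by (auto simp: simple_graph_def intro!: finite_subset[of X "Pow V"])
  then show ?thesis using assms
  proof (induction)
    case empty
    have "inj_on (reach_class V {}) V"
      by (auto simp: inj_on_def reach_class_eq_iff)
    then show ?case by (simp add: card_image)
  next
    case (insert e X)
    have fV: "finite V" using insert.prems by (simp add: simple_graph_def)
    have sX: "simple_graph V X" "forest X"
      using insert.prems by (auto simp: simple_graph_def intro: forest_subset)
    have "e \<subseteq> V" "card e = 2" using insert.prems by (auto simp: simple_graph_def)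
    then obtain a b where e: "e = {a, b}" and ab: "a \<in> V" "b \<in> V"
      by (auto simp: card_2_iff)
    have nr: "\<not> reach X a b"
      using insert.prems(2) insert.hyps(2) e unfolding forest_def by auto
    let ?C = "reach_class V X" and ?D = "reach_class V (insert e X)"
    have r: "reach (insert e X) u v \<longleftrightarrow>
        reach X u v \<or> reach X u a \<and> reach X b v \<or> reach X u b \<and> reach X a v" for u v
    proof
      show "reach (insert e X) u v" if "reach X u v \<or> reach X u a \<and> reach X b v \<or> reach X u b \<and> reach X a v"
      proof -
        have "reach (insert e X) a b" using e by (simp add: reach_edge)
        then show ?thesis using that reach_mono[of X _ _ "insert e X"]
          by (metis reach_sym reach_trans subset_insertI)
      qed
    qed (use reach_insert[of a b X u v] e in simp)
    have D1: "?D u = ?C u" if "\<not> reach X u a" "\<not> reach X u b" for u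
      using that by (auto simp: reach_class_def r)
    have D2: "?D u = ?C a \<union> ?C b" if "reach X u a \<or> reach X u b" for u
      using that by (auto simp: reach_class_def r) (metis reach_sym reach_trans)+
    have "?D ` V = insert (?C a \<union> ?C b) (?C ` V - {?C a, ?C b})" (is "_ = ?R")
    proof
      show "?D ` V \<subseteq> ?R"
      proof (rule image_subsetI)
        fix u assume u: "u \<in> V"
        show "?D u \<in> ?R"
        proof (cases "reach X u a \<or> reach X u b")
          case True
          then show ?thesis using D2[of u] by simp
        next
          case False
          then have "?C u \<noteq> ?C a" "?C u \<noteq> ?C b" using u ab by (simp_all add: reach_class_eq_iff)
          then show ?thesis using D1[of u] False u by simp
        qed
      qed
      show "?R \<subseteq> ?D ` V"
      proof
        fix c assume "c \<in> ?R"
        then consider "c = ?C a \<union> ?C b" | u where "u \<in> V" "c = ?C u" "?C u \<noteq> ?C a" "?C u \<noteq> ?C b"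
          by auto
        then show "c \<in> ?D ` V"
        proof cases
          case 1
          then show ?thesis using D2[of a] ab by auto
        next
          case 2
          then have "?D u = c" using D1[of u] reach_class_eq_iff ab by metis
          then show ?thesis using 2 by auto
        qed
      qed
    qed
    moreover have "?C a \<union> ?C b \<notin> ?C ` V"
    proof
      assume "?C a \<union> ?C b \<in> ?C ` V"
      then obtain w where w: "w \<in> V" "?C a \<union> ?C b = ?C w" by auto
      have "a \<in> ?C w" "b \<in> ?C w" using w(2) ab by (auto simp: reach_class_def)
      then have "reach X w a" "reach X w b" by (simp_all add: reach_class_def)
      then show False using nr reach_sym[of X w a] reach_trans[of X a w b] by simp
    qed
    moreover have "?C a \<noteq> ?C b" using nr ab by (simp add: reach_class_eq_iff)
    moreover have "card {?C a, ?C b} \<le> card (?C ` V)"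
      using ab fV by (intro card_mono) auto
    ultimately have "card (?D ` V) + 1 = card (?C ` V)"
      using ab fV by (simp add: card_Diff_subset)
    then show ?case
      using insert.IH sX insert.hyps by simp
  qed
qed

section \<open>Faces of a plane graph\<close>

text \<open>The inverse \<open>h\<close> of the arc would be a continuous injection of a disc into
  the reals. Take three points of the disc and delete the one whose value lies between the other
  two: the disc stays connected, but its image does not.\<close>

lemma path_image_arc_interior:
  fixes c :: "real \<Rightarrow> complex"
  assumes "arc c" and "open S" and "S \<noteq> {}"
  shows "\<not> S \<subseteq> path_image c"
proof
  assume S: "S \<subseteq> path_image c"
  obtain h where h: "homeomorphism {0..1} (path_image c) c h"
    using homeomorphism_arc[OF assms(1)] by blast
  from assms(2,3) obtain z r where r: "r > 0" "ball z r \<subseteq> S"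
    by (meson ex_in_conv openE)
  let ?B = "ball z r"
  have B: "?B \<subseteq> path_image c" using r S by auto
  have inj: "inj_on h ?B"
    by (rule inj_on_inverseI[of _ c]) (use h B in \<open>auto simp: homeomorphism_apply2\<close>)
  have cont: "continuous_on (path_image c) h"
    using h by (simp add: homeomorphism_def)
  let ?p = "z" and ?q = "z + of_real (r/2)" and ?s = "z - of_real (r/2)"
  have mem: "?p \<in> ?B" "?q \<in> ?B" "?s \<in> ?B"
    using r by (auto simp: dist_norm)
  have ne: "?p \<noteq> ?q" "?q \<noteq> ?s" "?p \<noteq> ?s"
    using r by (auto simp: complex_eq_iff)
  have between: False if abc: "a \<in> ?B" "b \<in> ?B" "d \<in> ?B" "h a < h d" "h d < h b" for a b d
  proof -
    have "connected (?B - {d})"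
      by (rule connected_open_delete) auto
    moreover have "continuous_on (?B - {d}) h"
      using cont B by (meson Diff_subset continuous_on_subset order_trans)
    ultimately have "connected (h ` (?B - {d}))"
      by (rule connected_continuous_image[rotated])
    moreover have "h a \<in> h ` (?B - {d})" "h b \<in> h ` (?B - {d})"
      using abc by auto
    ultimately have "h d \<in> h ` (?B - {d})"
      using abc(4,5) by (meson connectedD_interval less_imp_le)
    then show False
      using inj abc(3) by (auto simp: inj_on_def)
  qed
  have "h ?p \<noteq> h ?q" "h ?q \<noteq> h ?s" "h ?p \<noteq> h ?s"
    using inj mem ne by (auto dest: inj_onD)
  then show False
    using between mem by (metis linorder_neqE)
qed

section \<open>Drawings of edge subsets and Janiszewski's theorem\<close>

locale plane_graph =
  fixes V :: "'a set" and E :: "'a set set" and p :: "'a \<Rightarrow> complex"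
    and g :: "'a set \<Rightarrow> real \<Rightarrow> complex"
  assumes graph: "simple_graph V E" and drawing: "plane_drawing V E p g"
begin

lemma finite_V: "finite V"
  using graph by (simp add: simple_graph_def)

lemma finite_E: "finite E"
  using graph by (auto simp: simple_graph_def intro!: finite_subset[of E "Pow V"])

lemma edge_subset: "e \<in> E \<Longrightarrow> e \<subseteq> V"
  using graph by (simp add: simple_graph_def)

lemma edge_obtain:
  assumes "e \<in> E" obtains u v where "e = {u, v}" "u \<noteq> v" "u \<in> V" "v \<in> V"
proof -
  have "card e = 2" "e \<subseteq> V"
    using assms graph by (auto simp: simple_graph_def)
  then show ?thesis using that by (auto simp: card_2_iff)
qed

lemma inj_p: "inj_on p V"
  using drawing by (simp add: plane_drawing_def)

lemma arc_g: "e \<in> E \<Longrightarrow> arc (g e)"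
  using drawing by (simp add: plane_drawing_def)

lemma endpoints: "e \<in> E \<Longrightarrow> {pathstart (g e), pathfinish (g e)} = p ` e"
  using drawing by (simp add: plane_drawing_def)

lemma arc_vertices: "e \<in> E \<Longrightarrow> path_image (g e) \<inter> p ` V = p ` e"
  using drawing by (simp add: plane_drawing_def)

lemma arcs_meet:
  "e \<in> E \<Longrightarrow> f \<in> E \<Longrightarrow> e \<noteq> f \<Longrightarrow> path_image (g e) \<inter> path_image (g f) \<subseteq> p ` (e \<inter> f)"
  using drawing by (simp add: plane_drawing_def)

text \<open>All vertices belong to the support whatever \<open>X\<close> is. Inserting an edge
  therefore adds only its open arc, and isolated vertices do no harm, since finitely many points
  never separate the plane.\<close>

definition support :: "'a set set \<Rightarrow> complex set" where
  "support X = p ` V \<union> (\<Union>e\<in>X. path_image (g e))"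

definition arc_interior :: "'a set \<Rightarrow> complex set" where
  "arc_interior e = path_image (g e) - p ` e"

lemma support_insert: "support (insert e X) = support X \<union> path_image (g e)"
  by (auto simp: support_def)

lemma support_mono: "X \<subseteq> Y \<Longrightarrow> support X \<subseteq> support Y"
  by (auto simp: support_def)

lemma compact_arc: "e \<in> E \<Longrightarrow> compact (path_image (g e))"
  using arc_g by (simp add: compact_arc_image)

lemma compact_support: "X \<subseteq> E \<Longrightarrow> compact (support X)"
  unfolding support_def using finite_V finite_E compact_arc
  by (intro compact_Un[OF finite_imp_compact] compact_UN finite_imageI)
     (auto intro: finite_subset)

lemma open_compl_support: "X \<subseteq> E \<Longrightarrow> open (- support X)"
  using compact_support compact_imp_closed by blast

lemma arc_meets_support:
  assumes "X \<subseteq> E" "e \<in> E" "e \<notin> X"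
  shows "path_image (g e) \<inter> support X = p ` e"
proof -
  have "path_image (g e) \<inter> path_image (g f) \<subseteq> p ` e" if "f \<in> X" for f
    using arcs_meet[of e f] that assms by blast
  then show ?thesis
    using arc_vertices[OF assms(2)] by (auto simp: support_def)
qed

lemma arc_interior_props:
  assumes "e \<in> E"
  shows "arc_interior e \<noteq> {}" "connected (arc_interior e)"
    "arc_interior e \<subseteq> path_image (g e)" "path_image (g e) = arc_interior e \<union> p ` e"
proof -
  have s: "simple_path (g e)" using arc_g[OF assms] arc_imp_simple_path by blast
  show "arc_interior e \<noteq> {}" "connected (arc_interior e)"
    using nonempty_simple_path_endless[OF s] connected_simple_path_endless[OF s]
    by (simp_all add: arc_interior_def endpoints[OF assms])
  show "arc_interior e \<subseteq> path_image (g e)" "path_image (g e) = arc_interior e \<union> p ` e"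
    using arc_vertices[OF assms] by (auto simp: arc_interior_def)
qed

lemma arc_interior_support:
  assumes "X \<subseteq> E" "e \<in> E" "x \<in> arc_interior e" "x \<in> support X"
  shows "e \<in> X"
  using arc_meets_support[of X e] assms by (auto simp: arc_interior_def)

lemma reach_path_component:
  assumes "X \<subseteq> E" "reach X u v" "u \<in> V"
  shows "path_component (support X) (p u) (p v)"
  using assms(2) unfolding reach_def
proof (induction rule: rtranclp_induct)
  case base
  show ?case using assms(3) by (simp add: support_def path_component_refl)
next
  case (step y z)
  have e: "{y, z} \<in> E" using step assms by auto
  have "path_connected (path_image (g {y, z}))"
    using arc_g[OF e] by (simp add: path_connected_path_image arc_imp_path)
  moreover have "p y \<in> path_image (g {y, z})" "p z \<in> path_image (g {y, z})"
    using arc_vertices[OF e] by auto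
  ultimately have "path_component (path_image (g {y, z})) (p y) (p z)"
    by (simp add: path_connected_component)
  then have "path_component (support X) (p y) (p z)"
    by (rule path_component_of_subset[rotated]) (use step in \<open>auto simp: support_def\<close>)
  then show ?case using step.IH path_component_trans by blast
qed

text \<open>The part of the drawing reachable from u and the remaining part are disjoint compact
  sets, which is the input that Janiszewski's theorem needs in \<open>bridge\<close>.\<close>

lemma unreachable_split:
  assumes X: "X \<subseteq> E" and uv: "u \<in> V" "v \<in> V" "\<not> reach X u v"
  obtains K L where "compact K" "compact L" "K \<inter> L = {}" "support X = K \<union> L"
    "p u \<in> K" "p v \<in> L"
proof -
  define U where "U = {w \<in> V. reach X u w}"
  let ?K = "p ` U \<union> (\<Union>e\<in>{e\<in>X. e \<subseteq> U}. path_image (g e))"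
  let ?L = "p ` (V - U) \<union> (\<Union>e\<in>{e\<in>X. e \<inter> U = {}}. path_image (g e))"
  have dich: "e \<subseteq> U \<or> e \<inter> U = {}" if "e \<in> X" for e
  proof -
    have "e \<in> E" using X that by auto
    then obtain a b where ab: "e = {a, b}" "a \<in> V" "b \<in> V" by (metis edge_obtain)
    have "reach X u a \<longleftrightarrow> reach X u b"
      using that ab reach_edge reach_trans reach_sym by metis
    then show ?thesis using ab by (auto simp: U_def)
  qed
  have disj: "path_image (g e) \<inter> path_image (g f) = {}" if "e \<in> X" "f \<in> X" "e \<subseteq> U" "f \<inter> U = {}" for e f
  proof -
    have "e \<in> E" "f \<in> E" using X that by auto
    moreover have "e \<noteq> {}" using \<open>e \<in> E\<close> by (metis edge_obtain insert_not_empty)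
    moreover have "e \<inter> f = {}" using that by auto
    ultimately have "e \<noteq> f" by auto
    then show ?thesis
      using arcs_meet[of e f] \<open>e \<in> E\<close> \<open>f \<in> E\<close> \<open>e \<inter> f = {}\<close> by auto
  qed
  have ve: "p w \<in> path_image (g e) \<longleftrightarrow> w \<in> e" if "e \<in> X" "w \<in> V" for e w
  proof -
    have "e \<in> E" using X that by auto
    then have "p w \<in> path_image (g e) \<longleftrightarrow> p w \<in> p ` e"
      using arc_vertices[of e] that by blast
    then show ?thesis
      using inj_on_image_mem_iff[OF inj_p that(2) edge_subset[OF \<open>e \<in> E\<close>]] by simp
  qed
  have "U \<subseteq> V" by (auto simp: U_def)
  have sX: "support X = ?K \<union> ?L"
    using dich \<open>U \<subseteq> V\<close> unfolding support_def by blast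
  have "?K \<inter> ?L = {}"
  proof (rule ccontr)
    assume "?K \<inter> ?L \<noteq> {}"
    then obtain x where x: "x \<in> ?K" "x \<in> ?L" by auto
    have False if "x = p w" "x = p w'" "w \<in> U" "w' \<in> V - U" for w w'
      using that inj_p \<open>U \<subseteq> V\<close> by (auto dest: inj_onD)
    moreover have False if "x = p w" "w \<in> U" "e \<in> X" "e \<inter> U = {}" "x \<in> path_image (g e)" for w e
      using that ve[of e w] \<open>U \<subseteq> V\<close> by auto
    moreover have False if "x = p w" "w \<in> V - U" "e \<in> X" "e \<subseteq> U" "x \<in> path_image (g e)" for w e
      using that ve[of e w] by auto
    moreover have False if "e \<in> X" "e \<subseteq> U" "f \<in> X" "f \<inter> U = {}"
        "x \<in> path_image (g e)" "x \<in> path_image (g f)" for e f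
      using disj that by blast
    ultimately show False using x by blast
  qed
  moreover have "compact ?K" "compact ?L"
    using finite_V finite_E X compact_arc \<open>U \<subseteq> V\<close>
    by (intro compact_Un[OF finite_imp_compact] compact_UN finite_imageI;
        auto intro: finite_subset)+
  moreover have "p u \<in> ?K" "p v \<in> ?L"
    using uv by (auto simp: U_def)
  ultimately show ?thesis using sX by (intro that[of ?K ?L])
qed

text \<open>A bridge does not separate the complement any further. Janiszewski's theorem is used
  three times: the arc meets \<open>K\<close> and \<open>L\<close> in one point each, so it can be
  added to either, and the two enlarged sets meet exactly in the arc, so they can be united.\<close>

lemma bridge:
  assumes X: "X \<subseteq> E" and e: "{u, v} \<in> E" and n: "\<not> reach X u v"
    and c: "connected_component (- support X) y z"
    and y: "y \<notin> path_image (g {u, v})" and z: "z \<notin> path_image (g {u, v})"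
  shows "connected_component (- support (insert {u, v} X)) y z"
proof -
  let ?A = "path_image (g {u, v})"
  have uv: "u \<in> V" "v \<in> V" using edge_subset[OF e] by auto
  obtain K L where KL: "compact K" "compact L" "K \<inter> L = {}" "support X = K \<union> L"
    "p u \<in> K" "p v \<in> L"
    using unreachable_split[OF X uv n] by blast
  have nX: "{u, v} \<notin> X" using n reach_edge by metis
  have meet: "?A \<inter> (K \<union> L) = {p u, p v}"
    using arc_meets_support[OF X e nX] KL(4) by auto
  have "connected (- ?A)"
    using connected_arc_complement[OF arc_g[OF e]] by simp
  then have cA: "connected_component (- ?A) y z"
    using y z by (simp add: connected_iff_connected_component)
  have cK: "connected_component (- K) y z" and cL: "connected_component (- L) y z"
    using c KL(4) by (auto elim: connected_component_of_subset)
  have "K \<inter> ?A = {p u}" "L \<inter> ?A = {p v}"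
    using meet KL by auto
  then have 1: "connected_component (- (K \<union> ?A)) y z" "connected_component (- (L \<union> ?A)) y z"
    using Janiszewski[OF KL(1) _ _ cK cA] Janiszewski[OF KL(2) _ _ cL cA] compact_arc[OF e]
    by (simp_all add: compact_imp_closed)
  have "(K \<union> ?A) \<inter> (L \<union> ?A) = ?A" using KL(3) by auto
  then have "connected ((K \<union> ?A) \<inter> (L \<union> ?A))"
    using arc_g[OF e] by (simp add: connected_arc_image)
  from Janiszewski[OF _ _ this 1]
  have "connected_component (- ((K \<union> ?A) \<union> (L \<union> ?A))) y z"
    using KL compact_arc[OF e] by (simp add: compact_Un compact_imp_closed)
  moreover have "(K \<union> ?A) \<union> (L \<union> ?A) = support (insert {u, v} X)"
    using KL(4) by (auto simp: support_insert)
  ultimately show ?thesis by simp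
qed

lemma forest_complement:
  assumes "X \<subseteq> E" "forest X"
  shows "connected (- support X)"
proof -
  have "finite X" using assms finite_E finite_subset by auto
  then show ?thesis using assms
  proof (induction)
    case empty
    have "path_connected (- (p ` V))"
      by (rule path_connected_complement_countable) (auto simp: finite_V countable_finite)
    then show ?case by (simp add: support_def path_connected_imp_connected)
  next
    case (insert e X)
    have eE: "e \<in> E" "X \<subseteq> E" using insert by auto
    obtain u v where uv: "e = {u, v}" using eE edge_obtain by metis
    have "\<not> reach X u v"
      using insert.prems(2) insert.hyps(2) uv unfolding forest_def by auto
    then have n: "connected_component (- support (insert e X)) y z"
      if "y \<notin> support (insert e X)" "z \<notin> support (insert e X)" for y z
    proof -
      have "connected (- support X)"
        using insert forest_subset by blast
      then have "connected_component (- support X) y z"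
        using that by (auto simp: support_insert connected_iff_connected_component)
      then show ?thesis
        using bridge[of X u v y z] that eE uv \<open>\<not> reach X u v\<close> by (auto simp: support_insert)
    qed
    then show ?case
      by (simp add: connected_iff_connected_component)
  qed
qed

text \<open>The arc of the new edge closes up with an arc \<open>q\<close> in the old support to a
  Jordan curve. This curve meets the old support exactly in \<open>q\<close>, which is connected, so
  by Janiszewski's theorem a face is cut by the new edge only as far as the curve separates
  it.\<close>

lemma chord_curve:
  assumes X: "X \<subseteq> E" and e: "{u, v} \<in> E" "{u, v} \<notin> X" and r: "reach X u v"
  obtains c where "simple_path c" "pathfinish c = pathstart c"
    "path_image (g {u, v}) \<subseteq> path_image c" "path_image c \<subseteq> support (insert {u, v} X)"
    "\<And>y z. connected_component (- support X) y z \<Longrightarrow> connected_component (- path_image c) y z \<Longrightarrow>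
      connected_component (- support (insert {u, v} X)) y z"
proof -
  let ?A = "path_image (g {u, v})"
  have uv: "u \<in> V" "v \<in> V" using edge_subset[OF e(1)] by auto
  have "u \<noteq> v" using edge_obtain[OF e(1)] by (metis doubleton_eq_iff)
  then have "p u \<noteq> p v" using inj_p uv by (auto dest: inj_onD)
  from reach_path_component[OF X r uv(1)]
  obtain q0 where q0: "path q0" "path_image q0 \<subseteq> support X" "pathstart q0 = p u" "pathfinish q0 = p v"
    by (auto simp: path_component_def)
  then obtain q where q: "arc q" "path_image q \<subseteq> support X" "pathstart q = p u" "pathfinish q = p v"
    using path_contains_arc[OF q0(1,3,4) \<open>p u \<noteq> p v\<close>] by (metis order_trans)
  obtain h where h: "arc h" "path_image h = ?A" "pathstart h = p v" "pathfinish h = p u"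
  proof (cases "pathstart (g {u, v}) = p v")
    case True
    then have "pathfinish (g {u, v}) = p u"
      using endpoints[OF e(1)] \<open>p u \<noteq> p v\<close> by (auto simp: doubleton_eq_iff)
    then show ?thesis using that[of "g {u, v}"] True arc_g[OF e(1)] by auto
  next
    case False
    then have "pathstart (g {u, v}) = p u" "pathfinish (g {u, v}) = p v"
      using endpoints[OF e(1)] by (auto simp: doubleton_eq_iff)
    then show ?thesis using that[of "reversepath (g {u, v})"] arc_g[OF e(1)]
      by (auto simp: arc_reversepath)
  qed
  have meet: "?A \<inter> support X = {p u, p v}"
    using arc_meets_support[OF X e] by auto
  have sp: "simple_path (q +++ h)"
    using q h meet by (intro simple_path_join_loop) auto
  have im: "path_image (q +++ h) = path_image q \<union> ?A"
    using q h by (simp add: path_image_join)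
  have "p u \<in> path_image q" "p v \<in> path_image q"
    using q(3,4) pathstart_in_path_image[of q] pathfinish_in_path_image[of q] by simp_all
  then have "?A \<inter> support X \<subseteq> path_image q" by (simp add: meet)
  then have "support X \<inter> path_image (q +++ h) = path_image q"
    using q(2) unfolding im by blast
  then have con: "connected (support X \<inter> path_image (q +++ h))"
    using q by (simp add: connected_arc_image)
  have cl: "closed (path_image (q +++ h))"
    using sp by (simp add: closed_simple_path_image)
  have un: "support X \<union> path_image (q +++ h) = support (insert {u, v} X)"
    using im q by (auto simp: support_insert)
  show ?thesis
  proof (rule that[OF sp])
    show "pathfinish (q +++ h) = pathstart (q +++ h)" using q h by simp
    show "path_image (g {u, v}) \<subseteq> path_image (q +++ h)" using im by auto
    show "path_image (q +++ h) \<subseteq> support (insert {u, v} X)" using un by auto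
    show "connected_component (- support (insert {u, v} X)) y z"
      if "connected_component (- support X) y z" "connected_component (- path_image (q +++ h)) y z"
      for y z
      using Janiszewski[OF compact_support[OF X] cl con that] by (simp add: un)
  qed
qed

text \<open>If \<open>e\<close> lies on a cycle, the two sides are those of a Jordan curve through \<open>e\<close>; if \<open>e\<close> is a bridge,
  both sides are the whole complement of its arc.\<close>

lemma edge_sides:
  assumes e: "e \<in> E"
  obtains S :: "bool \<Rightarrow> complex set" where
    "\<And>i. arc_interior e \<subseteq> closure (S i)" "- support E \<subseteq> S True \<union> S False"
    "\<And>i y z. connected_component (- support (E - {e})) y z \<Longrightarrow> y \<in> S i \<Longrightarrow> z \<in> S i \<Longrightarrow>
      connected_component (- support E) y z"
    "\<And>i. S i \<inter> path_image (g e) = {}" "\<And>i. open (S i)"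
proof -
  obtain u v where uv: "e = {u, v}" using e by (metis edge_obtain)
  let ?X = "E - {e}"
  have X: "?X \<subseteq> E" "e \<notin> ?X" "insert e ?X = E" using e by auto
  show ?thesis
  proof (cases "reach ?X u v")
    case True
    obtain c where c: "simple_path c" "pathfinish c = pathstart c"
      "path_image (g e) \<subseteq> path_image c" "path_image c \<subseteq> support E"
      "\<And>y z. connected_component (- support ?X) y z \<Longrightarrow> connected_component (- path_image c) y z \<Longrightarrow>
        connected_component (- support E) y z"
      using chord_curve[OF X(1), of u v] True e X uv by metis
    define S where "S = (\<lambda>b. if b then inside (path_image c) else outside (path_image c))"
    note J = Jordan_inside_outside[OF c(1,2)]
    have "inside (path_image c) \<subseteq> - path_image c" "outside (path_image c) \<subseteq> - path_image c"
      using J by (metis Un_upper1, metis Un_upper2)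
    then have Sc: "S i \<subseteq> - path_image c" for i
      by (simp add: S_def)
    show ?thesis
    proof (rule that[of S])
      show "arc_interior e \<subseteq> closure (S i)" for i
        using J c(3) arc_interior_props(3)[OF e] frontier_def
        by (cases i) (fastforce simp: S_def)+
      show "- support E \<subseteq> S True \<union> S False"
        using J c(4) by (auto simp: S_def)
      show "connected_component (- support E) y z"
        if "connected_component (- support ?X) y z" "y \<in> S i" "z \<in> S i" for i y z
      proof (rule c(5)[OF that(1)])
        have "connected (S i)" using J by (cases i) (simp_all add: S_def)
        then show "connected_component (- path_image c) y z"
          using that(2,3) Sc[of i] by (auto simp: connected_component_def)
      qed
      show "S i \<inter> path_image (g e) = {}" for i
        using c(3) Sc[of i] by blast
      show "open (S i)" for i using J by (auto simp: S_def)
    qed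
  next
    case False
    show ?thesis
    proof (rule that[of "\<lambda>_. - path_image (g e)"])
      have "closure (- path_image (g e)) = UNIV"
        using path_image_arc_interior[OF arc_g[OF e], of "interior (path_image (g e))"]
          interior_subset by (auto simp: closure_complement)
      then show "arc_interior e \<subseteq> closure (- path_image (g e))" by simp
      show "- support E \<subseteq> - path_image (g e) \<union> - path_image (g e)"
        using e by (auto simp: support_def)
      show "connected_component (- support E) y z"
        if "connected_component (- support ?X) y z" "y \<in> - path_image (g e)" "z \<in> - path_image (g e)" for y z
        using bridge[OF X(1), of u v y z] that False e uv X(3) by auto
      show "open (- path_image (g e))"
        using compact_arc[OF e] compact_imp_closed by blast
    qed auto
  qed
qed

text \<open>Euler's formula as a lower bound for the number of faces, with \<open>Y\<close> picking
  points in distinct faces. For a forest one point suffices by \<open>forest_card\<close>. Otherwise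
  some edge lies on a cycle; removing it and putting it back splits one face into two, because the
  Jordan curve through it separates points on either side of its arc.\<close>

lemma separated_points:
  assumes "X \<subseteq> E" "V \<noteq> {}"
  shows "\<exists>Y. finite Y \<and> Y \<subseteq> - support X \<and>
    (\<forall>y\<in>Y. \<forall>z\<in>Y. connected_component (- support X) y z \<longrightarrow> y = z) \<and>
    card X + 2 \<le> card Y + card V"
  using assms(1)
proof (induction "card X" arbitrary: X rule: less_induct)
  case less
  have fX: "finite X" using less.prems finite_E finite_subset by auto
  show ?case
  proof (cases "forest X")
    case True
    have "simple_graph V X" using graph less.prems by (auto simp: simple_graph_def)
    from forest_card[OF this True] have "card X + card (reach_class V X ` V) = card V" .
    moreover have "card (reach_class V X ` V) \<noteq> 0" using finite_V assms(2) by simp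
    moreover have "- support X \<noteq> {}"
      using compact_imp_bounded[OF compact_support[OF less.prems]] not_bounded_UNIV
      by (metis boolean_algebra.compl_zero double_complement)
    then obtain y where "y \<in> - support X" by auto
    ultimately show ?thesis by (intro exI[of _ "{y}"]) auto
  next
    case False
    then obtain u v where uv: "{u, v} \<in> X" "reach (X - {{u, v}}) u v"
      by (auto simp: forest_def)
    let ?e = "{u, v}" let ?X = "X - {?e}"
    have eE: "?e \<in> E" "?X \<subseteq> E" "insert ?e ?X = X" "?e \<notin> ?X" using uv less.prems by auto
    have "card ?X < card X" using uv(1) fX by (meson card_Diff1_less)
    from less.hyps[OF this eE(2)] obtain Y where Y: "finite Y" "Y \<subseteq> - support ?X"
      "\<And>y z. y \<in> Y \<Longrightarrow> z \<in> Y \<Longrightarrow> connected_component (- support ?X) y z \<Longrightarrow> y = z"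
      "card ?X + 2 \<le> card Y + card V" by blast
    obtain c where c: "simple_path c" "pathfinish c = pathstart c"
      "path_image (g ?e) \<subseteq> path_image c" "path_image c \<subseteq> support X"
      using chord_curve[OF eE(2) eE(1) eE(4) uv(2)] eE(3) by metis
    note J = Jordan_inside_outside[OF c(1,2)]
    obtain x where x: "x \<in> arc_interior ?e" using arc_interior_props[OF eE(1)] by auto
    have "x \<in> - support ?X" using arc_interior_support[OF eE(2,1) x] eE(4) by blast
    then obtain r where r: "r > 0" "ball x r \<subseteq> - support ?X"
      using open_compl_support[OF eE(2)] by (meson openE)
    have "x \<in> path_image c" using x c(3) arc_interior_props[OF eE(1)] by auto
    then have "x \<in> closure (inside (path_image c))" "x \<in> closure (outside (path_image c))"
      using J by (metis Diff_iff frontier_def)+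
    then obtain y1 y2 where y12: "y1 \<in> ball x r" "y1 \<in> inside (path_image c)"
      "y2 \<in> ball x r" "y2 \<in> outside (path_image c)"
      using r(1) by (metis closure_approachable dist_commute mem_ball)
    have c12: "connected_component (- support ?X) y1 y2"
      using r y12 by (meson connected_ball connected_component_def)
    have n12: "\<not> connected_component (- support X) y1 y2"
    proof
      assume "connected_component (- support X) y1 y2"
      then have "connected_component (- path_image c) y1 y2"
        by (rule connected_component_of_subset) (use c(4) in auto)
      then have "y2 \<in> inside (path_image c)" using y12 inside_same_component by blast
      then show False using J y12 by blast
    qed
    have sX: "support X = support ?X \<union> path_image (g ?e)"
      using support_insert[of ?e ?X] eE(3) by simp
    have y12X: "y1 \<notin> support X" "y2 \<notin> support X"
    proof -
      have "inside (path_image c) \<subseteq> - path_image c" "outside (path_image c) \<subseteq> - path_image c"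
        using J by (metis Un_upper1, metis Un_upper2)
      then have "y1 \<notin> path_image (g ?e)" "y2 \<notin> path_image (g ?e)" using y12 c(3) by blast+
      then show "y1 \<notin> support X" "y2 \<notin> support X" using y12 r(2) by (auto simp: sX)
    qed
    have sub: "connected_component (- support ?X) a b" if "connected_component (- support X) a b" for a b
      by (rule connected_component_of_subset[OF that]) (auto simp: sX)
    have "\<exists>y'. connected_component (- support ?X) y y' \<and> y' \<notin> path_image (g ?e)" if "y \<in> Y" for y
    proof -
      have "open (connected_component_set (- support ?X) y)"
        using open_compl_support[OF eE(2)] by (rule open_connected_component)
      moreover have "y \<in> connected_component_set (- support ?X) y"
        using that Y(2) by auto
      ultimately show ?thesis
        using path_image_arc_interior[OF arc_g[OF eE(1)]] by blast
    qed
    \<comment> \<open>A representative may happen to lie on the new arc. It is moved within its old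
      face, which is open and so not contained in an arc.\<close>
    then obtain f where f: "\<And>y. y \<in> Y \<Longrightarrow> connected_component (- support ?X) y (f y)"
      "\<And>y. y \<in> Y \<Longrightarrow> f y \<notin> path_image (g ?e)" by metis
    \<comment> \<open>At most one old representative shares the face of \<open>y1\<close> and
      \<open>y2\<close>. It is dropped and both of these points are added, a net gain of at least
      one.\<close>
    let ?Z = "{y \<in> Y. \<not> connected_component (- support ?X) y y1}"
    have fne: "\<not> connected_component (- support ?X) (f y) y1" if "y \<in> ?Z" for y
      using that f(1)[of y] connected_component_trans[of "- support ?X" y "f y" y1] by auto
    have fin: "y = z" if "y \<in> Y" "z \<in> Y" "connected_component (- support ?X) (f y) (f z)" for y z
      using Y(3)[OF that(1,2)] connected_component_trans[OF f(1)[OF that(1)]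
        connected_component_trans[OF that(3) connected_component_sym[OF f(1)[OF that(2)]]]] by simp
    have fX': "f y \<notin> support X" if "y \<in> Y" for y
      using f[OF that] connected_component_in[OF f(1)[OF that]] by (auto simp: sX)
    let ?Y = "insert y1 (insert y2 (f ` ?Z))"
    have "card Y \<le> card ?Z + 1"
    proof -
      have "card (Y - ?Z) \<le> 1"
      proof (rule card_le_Suc0_iff_eq[THEN iffD2, unfolded One_nat_def[symmetric]])
        show "finite (Y - ?Z)" using Y(1) by simp
        show "\<forall>a\<in>Y - ?Z. \<forall>b\<in>Y - ?Z. a = b"
        proof (intro ballI)
          fix a b assume ab: "a \<in> Y - ?Z" "b \<in> Y - ?Z"
          then have "connected_component (- support ?X) a y1" "connected_component (- support ?X) y1 b"
            using connected_component_sym by auto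
          then show "a = b" using Y(3)[of a b] connected_component_trans ab by blast
        qed
      qed
      moreover have "card (Y - ?Z) = card Y - card ?Z" using Y(1) by (intro card_Diff_subset) auto
      ultimately show ?thesis by linarith
    qed
    moreover have "card ?Y = card ?Z + 2"
    proof -
      have "inj_on f ?Z"
      proof (rule inj_onI)
        fix y z assume "y \<in> ?Z" "z \<in> ?Z" "f y = f z"
        then show "y = z" using fin[of y z] connected_component_in[OF f(1)[of y]] by auto
      qed
      moreover have "y1 \<notin> f ` ?Z" using f(1) by auto
      moreover have "y2 \<notin> f ` ?Z"
        using fne connected_component_sym[OF c12] by auto
      moreover have "y1 \<noteq> y2" using y12(2,4) J by blast
      ultimately show ?thesis using Y(1) by (simp add: card_image)
    qed
    moreover have "card X = card ?X + 1" using card.remove[OF fX uv(1)] by (simp only: Suc_eq_plus1)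
    ultimately have "card X + 2 \<le> card ?Y + card V" using Y(4) by linarith
    moreover have "a = b" if "a \<in> ?Y" "b \<in> ?Y" "connected_component (- support X) a b" for a b
    proof (rule ccontr)
      assume "a \<noteq> b"
      have A: False if "y \<in> ?Z" "connected_component (- support X) (f y) t" "t \<in> {y1, y2}" for y t
        using that(3) fne[OF that(1)] sub[OF that(2)] connected_component_sym[OF c12]
          connected_component_trans[of _ "f y" y2 y1] by auto
      have s: "connected_component (- support X) b a" using that(3) connected_component_sym by blast
      from that \<open>a \<noteq> b\<close> consider "a \<in> {y1, y2}" "b \<in> {y1, y2}" | y where "y \<in> ?Z" "a = f y" "b \<in> {y1, y2}"
        | y where "y \<in> ?Z" "b = f y" "a \<in> {y1, y2}" | y z where "y \<in> ?Z" "z \<in> ?Z" "a = f y" "b = f z"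
        by blast
      then show False
      proof cases
        case 1
        then show False using that(3) s n12 \<open>a \<noteq> b\<close> by auto
      next
        case 2
        then show False using A that(3) by blast
      next
        case 3
        then show False using A s by blast
      next
        case 4
        then show False using fin[of y z] sub[OF that(3)] \<open>a \<noteq> b\<close> by auto
      qed
    qed
    moreover have "finite ?Y" "?Y \<subseteq> - support X" using Y(1) y12X fX' by auto
    ultimately show ?thesis by blast
  qed
qed

section \<open>Incidence between faces and edges\<close>

abbreviation face :: "complex \<Rightarrow> complex set" where
  "face y \<equiv> connected_component_set (- support E) y"

text \<open>Incidence is tested on the open arc, so a face that touches \<open>e\<close> only at an
  endpoint does not count; otherwise no bound of two faces per edge could hold.\<close>

definition adj :: "complex \<Rightarrow> 'a set \<Rightarrow> bool" where
  "adj y e \<longleftrightarrow> arc_interior e \<inter> closure (face y) \<noteq> {}"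

text \<open>The frontier of the face is covered by the vertices and the adjacent edges. If these
  edges formed a forest, the complement of their support would be connected, so the face would fill
  all of it. Then no further edge could be drawn and the whole graph would be a forest.\<close>

lemma face_boundary_not_forest:
  assumes "\<not> forest E" "y \<notin> support E"
  shows "\<not> forest {e \<in> E. adj y e}"
proof
  let ?A = "{e \<in> E. adj y e}"
  assume "forest ?A"
  then have con: "connected (- support ?A)" by (intro forest_complement) auto
  have "frontier (face y) \<subseteq> support ?A"
  proof
    fix x assume x: "x \<in> frontier (face y)"
    then have "x \<in> frontier (- support E)" using frontier_of_connected_component_subset by blast
    then have "x \<in> support E"
      using frontier_subset_closed[OF compact_imp_closed[OF compact_support[OF order_refl]]]
      by (auto simp: frontier_complement)
    then consider "x \<in> p ` V" | e where "e \<in> E" "x \<in> path_image (g e)" by (auto simp: support_def)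
    then show "x \<in> support ?A"
    proof cases
      case 2
      have "x \<in> closure (face y)" using x by (simp add: frontier_def)
      moreover have "x \<in> arc_interior e \<or> x \<in> p ` V"
        using arc_interior_props(4)[OF 2(1)] 2 edge_subset by auto
      ultimately show ?thesis using 2 by (auto simp: support_def adj_def)
    qed (simp add: support_def)
  qed
  moreover have "y \<in> face y" using assms(2) by simp
  moreover have sub: "face y \<subseteq> - support E" by (rule connected_component_subset)
  moreover have "support ?A \<subseteq> support E" by (rule support_mono) auto
  ultimately have "- support ?A \<subseteq> face y"
    using connected_Int_frontier[OF con, of "face y"] by blast
  then have "support E \<subseteq> support ?A" using sub by auto
  have "E \<subseteq> ?A"
  proof
    fix e assume e: "e \<in> E"
    then obtain x where x: "x \<in> arc_interior e" using arc_interior_props by blast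
    then have "x \<in> support E" using e arc_interior_props[OF e] by (auto simp: support_def)
    then show "e \<in> ?A"
      using arc_interior_support[of ?A e x] x e \<open>support E \<subseteq> support ?A\<close> by auto
  qed
  then show False using \<open>forest ?A\<close> assms(1) forest_subset by blast
qed

text \<open>Near a point of the open arc, each side given by \<open>edge_sides\<close> lies in at
  most one face. Since the open arc is connected, a face that occupies a side near one point does so
  along the whole arc. Sending each adjacent face to a side it occupies is therefore injective into
  \<open>bool\<close>.\<close>

lemma edge_two_faces:
  assumes e: "e \<in> E" and Y: "Y \<subseteq> - support E"
    "\<And>y z. y \<in> Y \<Longrightarrow> z \<in> Y \<Longrightarrow> connected_component (- support E) y z \<Longrightarrow> y = z"
  shows "card {y \<in> Y. adj y e} \<le> 2"
proof -
  obtain S where S: "\<And>i. arc_interior e \<subseteq> closure (S i)" "- support E \<subseteq> S True \<union> S False"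
    "\<And>i y z. connected_component (- support (E - {e})) y z \<Longrightarrow> y \<in> S i \<Longrightarrow> z \<in> S i \<Longrightarrow>
      connected_component (- support E) y z"
    "\<And>i. S i \<inter> path_image (g e) = {}" "\<And>i. open (S i)"
    using edge_sides[OF e] by metis
  have loc: "\<exists>r>0. \<forall>i y. ball x r \<inter> S i \<inter> face y \<noteq> {} \<longrightarrow> ball x r \<inter> S i \<subseteq> face y"
    if x: "x \<in> arc_interior e" for x
  proof -
    have "x \<in> - support (E - {e})" using arc_interior_support[of "E - {e}" e x] x e by auto
    then obtain r where r: "r > 0" "ball x r \<subseteq> - support (E - {e})"
      using open_compl_support[of "E - {e}"] by (metis Diff_subset openE)
    show ?thesis
    proof (intro exI[of _ r] conjI allI impI subsetI r(1))
      fix i y w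
      assume "ball x r \<inter> S i \<inter> face y \<noteq> {}" and w: "w \<in> ball x r \<inter> S i"
      then obtain z where z: "z \<in> ball x r" "z \<in> S i" "connected_component (- support E) y z" by auto
      have "connected_component (- support (E - {e})) z w"
        using z w r by (meson IntD1 connected_ball connected_component_def)
      then have "connected_component (- support E) z w" using S(3) z w by blast
      then show "w \<in> face y" using z(3) connected_component_trans by (metis mem_Collect_eq)
    qed
  qed
  have side: "\<exists>i. \<forall>x\<in>arc_interior e. \<exists>r>0. ball x r \<inter> S i \<subseteq> face y" if ad: "adj y e" for y
  proof -
    obtain x where x: "x \<in> arc_interior e" "x \<in> closure (face y)" using ad unfolding adj_def by blast
    obtain r where r: "r > 0" "\<And>i y. ball x r \<inter> S i \<inter> face y \<noteq> {} \<Longrightarrow> ball x r \<inter> S i \<subseteq> face y"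
      using loc[OF x(1)] by blast
    obtain z where z: "z \<in> face y" "z \<in> ball x r"
      using x(2) r(1) by (metis closure_approachable dist_commute mem_ball)
    have "z \<in> - support E" using z(1) connected_component_in by fastforce
    then obtain i where i: "z \<in> S i" using S(2) by blast
    have base: "\<exists>r>0. ball x r \<inter> S i \<subseteq> face y" using r z i by blast
    have "\<exists>r>0. ball w r \<inter> S i \<subseteq> face y" if w: "w \<in> arc_interior e" for w
    proof (rule connected_induction_simple[where P="\<lambda>w. \<exists>r>0. ball w r \<inter> S i \<subseteq> face y",
          OF arc_interior_props(2)[OF e] x(1) w base])
      fix a assume a: "a \<in> arc_interior e"
      obtain r where r: "r > 0" "\<And>i y. ball a r \<inter> S i \<inter> face y \<noteq> {} \<Longrightarrow> ball a r \<inter> S i \<subseteq> face y"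
        using loc[OF a] by blast
      have "\<exists>r>0. ball d r \<inter> S i \<subseteq> face y"
        if bd: "b \<in> arc_interior e" "b \<in> ball a r" "d \<in> ball a r" "s > 0" "ball b s \<inter> S i \<subseteq> face y" for b d s
      proof -
        have "open (ball a r \<inter> ball b s)" "b \<in> ball a r \<inter> ball b s" "b \<in> closure (S i)"
          using bd S(1) by auto
        then have "(ball a r \<inter> ball b s) \<inter> S i \<noteq> {}"
          using open_Int_closure_eq_empty[of "ball a r \<inter> ball b s" "S i"] by auto
        then have "ball a r \<inter> S i \<subseteq> face y" using bd(5) r(2)[of i y] by blast
        moreover obtain q where "q > 0" "ball d q \<subseteq> ball a r" using bd(3) by (meson open_ball openE)
        ultimately show ?thesis by blast
      qed
      then show "\<exists>T. openin (top_of_set (arc_interior e)) T \<and> a \<in> T \<and>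
          (\<forall>b\<in>T. \<forall>d\<in>T. (\<exists>r>0. ball b r \<inter> S i \<subseteq> face y) \<longrightarrow> (\<exists>r>0. ball d r \<inter> S i \<subseteq> face y))"
        using a r(1) by (intro exI[of _ "arc_interior e \<inter> ball a r"]) (auto simp: openin_open_Int)
    qed
    then show ?thesis by blast
  qed
  then obtain \<sigma> where \<sigma>: "\<And>y x. adj y e \<Longrightarrow> x \<in> arc_interior e \<Longrightarrow> \<exists>r>0. ball x r \<inter> S (\<sigma> y) \<subseteq> face y"
    by metis
  have "inj_on \<sigma> {y \<in> Y. adj y e}"
  proof (rule inj_onI; clarify)
    fix y z assume yz: "y \<in> Y" "adj y e" "z \<in> Y" "adj z e" "\<sigma> y = \<sigma> z"
    obtain x where x: "x \<in> arc_interior e" using arc_interior_props[OF e] by auto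
    obtain r where r: "r > 0" "ball x r \<inter> S (\<sigma> y) \<subseteq> face y" using \<sigma>[OF yz(2) x] by auto
    obtain s where s: "s > 0" "ball x s \<inter> S (\<sigma> y) \<subseteq> face z" using \<sigma>[OF yz(4) x] yz(5) by auto
    have "open (ball x r \<inter> ball x s)" "x \<in> ball x r \<inter> ball x s" "x \<in> closure (S (\<sigma> y))"
      using r(1) s(1) x S(1) by auto
    then have "(ball x r \<inter> ball x s) \<inter> S (\<sigma> y) \<noteq> {}"
      using open_Int_closure_eq_empty[of "ball x r \<inter> ball x s" "S (\<sigma> y)"] by blast
    then obtain w where "w \<in> face y" "w \<in> face z" using r s by auto
    then have "connected_component (- support E) y z"
      using connected_component_trans connected_component_sym by (metis mem_Collect_eq)
    then show "y = z" using Y(2) yz by blast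
  qed
  then have "card {y \<in> Y. adj y e} \<le> card (UNIV :: bool set)"
    by (intro card_inj_on_le) auto
  then show ?thesis by simp
qed

text \<open>The relation \<open>R\<close> hides the topology: the contact bound below argues only
  with these counts.\<close>

theorem face_count:
  assumes "V \<noteq> {}" "\<not> forest E"
  obtains Y R where "finite (Y :: complex set)" "card E + 2 \<le> card Y + card V"
    "\<And>e. e \<in> E \<Longrightarrow> card {y \<in> Y. R y e} \<le> 2" "\<And>y. y \<in> Y \<Longrightarrow> \<not> forest {e \<in> E. R y e}"
proof -
  obtain Y where Y: "finite Y" "Y \<subseteq> - support E"
    "\<And>y z. y \<in> Y \<Longrightarrow> z \<in> Y \<Longrightarrow> connected_component (- support E) y z \<Longrightarrow> y = z"
    "card E + 2 \<le> card Y + card V"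
    using separated_points[OF order_refl assms(1)] by metis
  show ?thesis
  proof (rule that[OF Y(1,4)])
    show "card {y \<in> Y. adj y e} \<le> 2" if "e \<in> E" for e
      using edge_two_faces[OF that Y(2,3)] .
    show "\<not> forest {e \<in> E. adj y e}" if "y \<in> Y" for y
      using face_boundary_not_forest[OF assms(2)] that Y(2) by auto
  qed
qed

end

section \<open>Components and the planar contact bound\<close>

definition induced :: "'a set set \<Rightarrow> 'a set \<Rightarrow> 'a set set" where
  "induced E U = {e \<in> E. e \<subseteq> U}"

definition connected_in :: "'a set set \<Rightarrow> 'a set \<Rightarrow> bool" where
  "connected_in E D \<longleftrightarrow> D \<noteq> {} \<and> (\<forall>u\<in>D. \<forall>v\<in>D. reach (induced E D) u v)"

definition nbr :: "'a set set \<Rightarrow> 'a set \<Rightarrow> 'a set" where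
  "nbr E D = {w. w \<notin> D \<and> (\<exists>d\<in>D. {d, w} \<in> E)}"

text \<open>A component is described without a representative, as a connected set closed under
  adjacency inside \<open>U\<close>. Edges leaving \<open>U\<close> are ignored, so vertex deletion
  needs no new edge set.\<close>

definition comps :: "'a set set \<Rightarrow> 'a set \<Rightarrow> 'a set set" where
  "comps E U = {D. D \<subseteq> U \<and> connected_in E D \<and> nbr E D \<inter> U = {}}"

definition odd_comps :: "'a set set \<Rightarrow> 'a set \<Rightarrow> 'a set set" where
  "odd_comps E U = {D \<in> comps E U. odd (card D)}"

lemma induced_edge_iff [simp]: "{a, b} \<in> induced E U \<longleftrightarrow> {a, b} \<in> E \<and> a \<in> U \<and> b \<in> U"
  by (auto simp: induced_def)

lemma connected_in_mono:
  assumes "connected_in E D" "E \<subseteq> E'"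
  shows "connected_in E' D"
proof -
  have "induced E D \<subseteq> induced E' D" using assms(2) by (auto simp: induced_def)
  from reach_mono[OF _ this] show ?thesis using assms(1) by (simp add: connected_in_def)
qed

lemma connected_in_closed:
  assumes "connected_in E D" "x \<in> D" "x \<in> C" "\<And>a b. {a, b} \<in> E \<Longrightarrow> a \<in> D \<Longrightarrow> b \<in> D \<Longrightarrow> a \<in> C \<Longrightarrow> b \<in> C"
  shows "D \<subseteq> C"
proof
  fix y assume "y \<in> D"
  then have "reach (induced E D) x y" using assms by (simp add: connected_in_def)
  then show "y \<in> C" by (rule reach_closed) (use assms in auto)
qed

lemma connected_in_Un:
  assumes "connected_in E C" "connected_in E D" "c \<in> C" "d \<in> D" "{c, d} \<in> E"
  shows "connected_in E (C \<union> D)"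
proof -
  let ?r = "reach (induced E (C \<union> D))"
  have sub: "induced E C \<subseteq> induced E (C \<union> D)" "induced E D \<subseteq> induced E (C \<union> D)"
    by (auto simp: induced_def)
  have C: "?r u c" if "u \<in> C" for u
    by (rule reach_mono[OF _ sub(1)]) (use assms that in \<open>simp add: connected_in_def\<close>)
  have D: "?r u d" if "u \<in> D" for u
    by (rule reach_mono[OF _ sub(2)]) (use assms that in \<open>simp add: connected_in_def\<close>)
  have "?r d c" using assms by (intro reach_edge) (auto simp: insert_commute)
  then have *: "?r u c" if "u \<in> C \<union> D" for u
    using that C[of u] D[of u] reach_trans[of _ u d c] by blast
  have "?r u v" if "u \<in> C \<union> D" "v \<in> C \<union> D" for u v
    using reach_trans[OF *[OF that(1)]] *[OF that(2)] by (simp add: reach_sym[of _ c v])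
  then show ?thesis
    using assms(3) unfolding connected_in_def by blast
qed

lemma connected_in_insert:
  assumes "connected_in E D" "x \<in> nbr E D"
  shows "connected_in E (insert x D)"
proof -
  obtain d where "d \<in> D" "{x, d} \<in> E" using assms(2) by (auto simp: nbr_def insert_commute)
  moreover have "connected_in E {x}" by (simp add: connected_in_def)
  ultimately show ?thesis using connected_in_Un[of E "{x}" D x d] assms(1) by simp
qed

lemma comps_disjoint:
  assumes "C \<in> comps E U" "D \<in> comps E U" "C \<noteq> D"
  shows "C \<inter> D = {}"
proof -
  have "C \<subseteq> D" if "C \<in> comps E U" "D \<in> comps E U" "x \<in> C" "x \<in> D" for C D x
    by (rule connected_in_closed[of E C x]) (use that in \<open>auto simp: comps_def nbr_def\<close>)
  then show ?thesis using assms by blast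
qed

lemma Union_comps: "\<Union>(comps E U) = U"
proof
  show "U \<subseteq> \<Union>(comps E U)"
  proof
    fix u assume u: "u \<in> U"
    let ?D = "{v. reach (induced E U) u v}"
    have DU: "?D \<subseteq> U"
    proof
      fix v assume "v \<in> ?D"
      then show "v \<in> U" using reach_closed[of "induced E U" u v U] u by auto
    qed
    have r: "reach (induced E ?D) u v" if "reach (induced E U) u v" for v
      using that[unfolded reach_def[of "induced E U"]]
    proof (induction rule: rtranclp_induct)
      case (step y z)
      from step.hyps(1) have y: "reach (induced E U) u y" unfolding reach_def .
      then have "reach (induced E U) u z" using reach_trans reach_edge[OF step.hyps(2)] by metis
      then have "{y, z} \<in> induced E ?D" using y step.hyps(2) by simp
      then show ?case using step.IH reach_edge reach_trans by metis
    qed auto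
    have "connected_in E ?D"
      unfolding connected_in_def
    proof (intro conjI ballI)
      fix v w assume "v \<in> ?D" "w \<in> ?D"
      then have "reach (induced E ?D) v u" "reach (induced E ?D) u w"
        using r by (simp_all add: reach_sym[of _ v u])
      then show "reach (induced E ?D) v w" by (rule reach_trans)
    qed (use u in auto)
    moreover have "nbr E ?D \<inter> U = {}"
    proof (rule ccontr)
      assume "nbr E ?D \<inter> U \<noteq> {}"
      then obtain d w where dw: "d \<in> ?D" "w \<notin> ?D" "w \<in> U" "{d, w} \<in> E" by (auto simp: nbr_def)
      then have "reach (induced E U) d w" using DU by (intro reach_edge) auto
      then show False using dw(1,2) reach_trans[of _ u d w] by simp
    qed
    ultimately have "?D \<in> comps E U" using DU by (auto simp: comps_def)
    then show "u \<in> \<Union>(comps E U)" by (rule UnionI) simp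
  qed
qed (auto simp: comps_def)

lemma comps_finite: "finite U \<Longrightarrow> finite (comps E U)"
  by (rule finite_subset[of _ "Pow U"]) (auto simp: comps_def)

lemma comps_card:
  assumes "finite U" shows "(\<Sum>D\<in>comps E U. card D) = card U"
proof -
  have "pairwise disjnt (comps E U)"
    by (intro pairwiseI) (simp add: disjnt_def comps_disjoint)
  moreover have "finite D" if "D \<in> comps E U" for D
    using that assms finite_subset by (auto simp: comps_def)
  ultimately have "card (\<Union>(comps E U)) = (\<Sum>D\<in>comps E U. card D)"
    by (intro card_Union_disjoint)
  then show ?thesis by (simp add: Union_comps)
qed

lemma odd_comps_parity:
  assumes "finite U"
  shows "odd (card (odd_comps E U)) \<longleftrightarrow> odd (card U)"
  using even_sum_iff[of "comps E U" card] comps_finite[OF assms, of E] comps_card[OF assms, of E]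
  by (simp add: odd_comps_def)

lemma odd_comp_exists:
  assumes "finite U" "odd (card U)"
  obtains D where "D \<in> odd_comps E U"
  using odd_comps_parity[OF assms(1), of E] assms(2) by (metis card.empty equals0I even_zero)

lemma nbr_Int_empty_sym:
  assumes "C \<inter> D = {}" "nbr E C \<inter> D = {}"
  shows "nbr E D \<inter> C = {}"
proof (rule ccontr)
  assume "nbr E D \<inter> C \<noteq> {}"
  then obtain c d where cd: "c \<in> C" "d \<in> D" "{d, c} \<in> E" by (auto simp: nbr_def)
  then have "d \<in> nbr E C" using assms(1) by (auto simp: nbr_def insert_commute)
  then show False using assms(2) cd(2) by blast
qed

lemma comps_Diff:
  assumes D: "D \<in> comps E W" and X: "X \<subseteq> D"
  shows "comps E (W - X) = (comps E W - {D}) \<union> comps E (D - X)"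
proof
  show "comps E (W - X) \<subseteq> (comps E W - {D}) \<union> comps E (D - X)"
  proof
    fix C assume C: "C \<in> comps E (W - X)"
    show "C \<in> (comps E W - {D}) \<union> comps E (D - X)"
    proof (cases "C \<inter> D = {}")
      case True
      moreover have "nbr E D \<inter> C = {}" using C D by (auto simp: comps_def)
      ultimately have "nbr E C \<inter> D = {}" using nbr_Int_empty_sym[of D C E] by blast
      then have "C \<in> comps E W" using C X by (auto simp: comps_def)
      moreover have "C \<noteq> D" using True C by (auto simp: comps_def connected_in_def)
      ultimately show ?thesis by simp
    next
      case False
      then obtain x where x: "x \<in> C" "x \<in> D" by auto
      have "C \<subseteq> D"
        by (rule connected_in_closed[of E C x]) (use x C D in \<open>auto simp: comps_def nbr_def\<close>)
      then show ?thesis using C D by (auto simp: comps_def)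
    qed
  qed
  show "(comps E W - {D}) \<union> comps E (D - X) \<subseteq> comps E (W - X)"
  proof
    fix C assume "C \<in> (comps E W - {D}) \<union> comps E (D - X)"
    then show "C \<in> comps E (W - X)"
    proof
      assume C: "C \<in> comps E W - {D}"
      then have "C \<inter> D = {}" using comps_disjoint D by blast
      then show ?thesis using C X by (auto simp: comps_def)
    next
      assume C: "C \<in> comps E (D - X)"
      then have "nbr E C \<inter> (W - X) = {}" using D unfolding comps_def nbr_def by blast
      then show ?thesis using C D by (auto simp: comps_def)
    qed
  qed
qed

lemma connected_in_comps:
  assumes "connected_in E C" "C \<subseteq> U"
  obtains D where "D \<in> comps E U" "C \<subseteq> D"
proof -
  obtain x where x: "x \<in> C" using assms by (auto simp: connected_in_def)
  then obtain D where D: "D \<in> comps E U" "x \<in> D" using Union_comps[of E U] assms by blast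
  have "C \<subseteq> D"
    by (rule connected_in_closed[of E C x]) (use x assms D in \<open>auto simp: comps_def nbr_def\<close>)
  then show ?thesis using that D by blast
qed

section \<open>Counting contacts in a planar graph\<close>

lemma plane_drawing_subgraph:
  assumes "plane_drawing V E p g" "W \<subseteq> V" "F \<subseteq> E" "\<And>e. e \<in> F \<Longrightarrow> e \<subseteq> W"
  shows "plane_drawing W F p g"
proof -
  have "path_image (g e) \<inter> p ` W = p ` e" if "e \<in> F" for e
  proof -
    have "e \<in> E" using that assms(3) by auto
    then have "path_image (g e) \<inter> p ` V = p ` e" using assms(1) by (simp add: plane_drawing_def)
    then show ?thesis using assms(2) assms(4)[OF that] by blast
  qed
  then show ?thesis
    using assms(1-3) unfolding plane_drawing_def by (meson inj_on_subset subsetD)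
qed

lemma maximal_forest:
  assumes "finite I"
  obtains F where "F \<subseteq> I" "forest F" "\<And>u v. {u, v} \<in> I \<Longrightarrow> reach F u v"
proof -
  have "\<exists>F. (F \<subseteq> I \<and> forest F) \<and> (\<forall>F'. F' \<subseteq> I \<and> forest F' \<longrightarrow> card F' \<le> card F)"
    by (rule ex_has_greatest_nat[of _ "{}" _ "Suc (card I)"])
       (auto simp: less_Suc_eq_le assms card_mono)
  then obtain F where F: "F \<subseteq> I" "forest F" "\<And>F'. F' \<subseteq> I \<Longrightarrow> forest F' \<Longrightarrow> card F' \<le> card F" by blast
  have "reach F u v" if uv: "{u, v} \<in> I" for u v
  proof (rule ccontr)
    assume n: "\<not> reach F u v"
    then have "{u, v} \<notin> F" using reach_edge by metis
    then have "card (insert {u, v} F) = card F + 1"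
      using finite_subset[OF F(1) assms] by simp
    moreover have "card (insert {u, v} F) \<le> card F"
      using F(1) uv forest_insert[OF F(2) n] by (intro F(3)) auto
    ultimately show False by simp
  qed
  then show ?thesis using that F by blast
qed

lemma sum_card_swap:
  assumes "finite A" "finite B"
  shows "(\<Sum>a\<in>A. card {b \<in> B. R a b}) = (\<Sum>b\<in>B. card {a \<in> A. R a b})"
proof -
  have "(\<Sum>a\<in>A. card {b \<in> B. R a b}) = (\<Sum>a\<in>A. \<Sum>b\<in>B. if R a b then 1 else 0)"
    using assms by (intro sum.cong refl) (simp add: sum.If_cases Int_def)
  also have "\<dots> = (\<Sum>b\<in>B. \<Sum>a\<in>A. if R a b then 1 else 0)" by (rule sum.swap)
  also have "\<dots> = (\<Sum>b\<in>B. card {a \<in> A. R a b})"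
    using assms by (intro sum.cong refl) (simp add: sum.If_cases Int_def)
  finally show ?thesis .
qed

text \<open>Rather than contracting the sets in \<open>\<D>\<close>, the proof joins each of them by a part of a forest \<open>F\<close> and
  adds one edge for each contact. The boundary of a face contains a cycle, and a cycle uses at least four
  contact edges because it projects to an even subgraph of a simple bipartite graph.\<close>

theorem planar_contact_bound:
  assumes graph: "simple_graph V E" and planar: "planar V E"
    and TV: "T \<subseteq> V" and DV: "\<And>D. D \<in> \<D> \<Longrightarrow> D \<subseteq> V - T"
    and conn: "\<And>D. D \<in> \<D> \<Longrightarrow> connected_in E D"
    and disj: "\<And>C D. C \<in> \<D> \<Longrightarrow> D \<in> \<D> \<Longrightarrow> C \<noteq> D \<Longrightarrow> C \<inter> D = {}"
    and three: "3 \<le> card T + card \<D>"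
  shows "(\<Sum>D\<in>\<D>. card (nbr E D \<inter> T)) + 4 \<le> 2 * (card T + card \<D>)"
proof -
  have fV: "finite V" and eE: "\<And>e. e \<in> E \<Longrightarrow> e \<subseteq> V \<and> card e = 2"
    using graph by (auto simp: simple_graph_def)
  have fE: "finite E" using fV eE by (intro finite_subset[of E "Pow V"]) auto
  have fT: "finite T" using finite_subset[OF TV fV] .
  have fD: "finite \<D>" using fV DV by (intro finite_subset[of \<D> "Pow V"]) auto
  define P where "P = (SIGMA D:\<D>. nbr E D \<inter> T)"
  have fP: "finite P" using fT fD by (auto simp: P_def)
  have cP: "card P = (\<Sum>D\<in>\<D>. card (nbr E D \<inter> T))"
    using fT fD by (simp add: P_def)
  have "\<exists>d\<in>D. {d, t} \<in> E" if "(D, t) \<in> P" for D t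
    using that by (auto simp: P_def nbr_def)
  \<comment> \<open>One edge is fixed for each contact, even if D and t are joined by several. This
    is what makes the projected bipartite graph simple.\<close>
  then obtain \<delta> where \<delta>: "\<And>D t. (D, t) \<in> P \<Longrightarrow> \<delta> D t \<in> D" "\<And>D t. (D, t) \<in> P \<Longrightarrow> {\<delta> D t, t} \<in> E"
    by metis
  define r where "r = (\<lambda>(D, t). {\<delta> D t, t})"
  define R where "R = r ` P"
  have PD: "D \<in> \<D> \<and> t \<in> T" if "(D, t) \<in> P" for D t using that by (auto simp: P_def)
  have \<delta>T: "\<delta> D t \<notin> T" if "(D, t) \<in> P" for D t using \<delta>(1)[OF that] PD[OF that] DV by auto
  have uniq: "t = s \<and> C = D" if "(C, t) \<in> P" "(D, s) \<in> P" "{\<delta> C t, t} = {\<delta> D s, s}" for C D s t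
  proof -
    have "t = s" "\<delta> C t = \<delta> D s"
      using that(3) \<delta>T[OF that(1)] \<delta>T[OF that(2)] PD[OF that(1)] PD[OF that(2)]
      by (auto simp: doubleton_eq_iff)
    then have "\<delta> C t \<in> C \<inter> D" using \<delta>(1)[OF that(1)] \<delta>(1)[OF that(2)] by simp
    then show ?thesis using disj[of C D] PD[OF that(1)] PD[OF that(2)] \<open>t = s\<close> by auto
  qed
  have inj_r: "inj_on r P" using uniq by (auto simp: inj_on_def r_def)
  define I where "I = {e \<in> E. \<exists>D\<in>\<D>. e \<subseteq> D}"
  obtain F where F: "F \<subseteq> I" "forest F" "\<And>u v. {u, v} \<in> I \<Longrightarrow> reach F u v"
    using maximal_forest[of I] fE by (auto simp: I_def)
  have Fin: "b \<in> D" if Fab: "{a, b} \<in> F" "a \<in> D" "D \<in> \<D>" for a b D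
  proof -
    obtain C where "C \<in> \<D>" "{a, b} \<subseteq> C" using F(1) Fab(1) unfolding I_def by blast
    then show ?thesis using disj[of C D] Fab by auto
  qed
  have FT: "a \<notin> T" if "{a, b} \<in> F" for a b
    using F(1) DV that by (auto simp: I_def)
  let ?W = "T \<union> \<Union>\<D>"
  have WV: "?W \<subseteq> V" using TV DV by auto
  have fW: "finite ?W" using finite_subset[OF WV fV] .
  have cD: "reach_class ?W F u = D" if "D \<in> \<D>" "u \<in> D" for u D
  proof
    show "reach_class ?W F u \<subseteq> D" using reach_closed[of F u _ D] Fin that by (auto simp: reach_class_def)
    show "D \<subseteq> reach_class ?W F u"
    proof
      fix v assume "v \<in> D"
      then have "reach (induced E D) u v" using conn that by (auto simp: connected_in_def)
      then have "reach F u v" by (rule reach_subst) (use F(3) that in \<open>auto simp: I_def\<close>)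
      then show "v \<in> reach_class ?W F u" using \<open>v \<in> D\<close> that by (auto simp: reach_class_def)
    qed
  qed
  have cT: "reach_class ?W F u = {u}" if "u \<in> T" for u
  proof -
    have "v = u" if "reach F u v" for v
      using reach_closed[OF that, of "{u}"] FT \<open>u \<in> T\<close> by auto
    then show ?thesis using \<open>u \<in> T\<close> by (auto simp: reach_class_def)
  qed
  have neD: "D \<noteq> {}" if "D \<in> \<D>" for D using conn[OF that] by (simp add: connected_in_def)
  have "reach_class ?W F ` ?W = (\<lambda>t. {t}) ` T \<union> \<D>"
  proof -
    have "reach_class ?W F ` \<Union>\<D> = \<D>" using cD neD by (force simp: image_iff)
    moreover have "reach_class ?W F ` T = (\<lambda>t. {t}) ` T" using cT by auto
    ultimately show ?thesis by (simp add: image_Un)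
  qed
  moreover have "(\<lambda>t. {t}) ` T \<inter> \<D> = {}" using DV by auto
  ultimately have "card (reach_class ?W F ` ?W) = card T + card \<D>"
    using fT fD by (simp add: card_Un_disjoint card_image)
  moreover have FE: "F \<subseteq> E" "\<And>e. e \<in> F \<Longrightarrow> e \<subseteq> ?W" using F(1) by (auto simp: I_def)
  then have "simple_graph ?W F" using eE fW by (auto simp: simple_graph_def)
  ultimately have cF: "card F + (card T + card \<D>) = card ?W"
    using forest_card[OF _ F(2)] by metis
  let ?E = "F \<union> R"
  have RE: "R \<subseteq> E" "\<And>e. e \<in> R \<Longrightarrow> e \<subseteq> ?W"
    using \<delta> PD unfolding R_def r_def by fastforce+
  have sg: "simple_graph ?W ?E" unfolding simple_graph_def
  proof (intro conjI ballI fW)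
    fix e assume e: "e \<in> ?E"
    then show "e \<subseteq> ?W" using FE(2) RE(2) by (metis Un_iff)
    show "card e = 2" using e FE(1) RE(1) eE[of e] by blast
  qed
  have FR: "F \<inter> R = {}"
  proof (rule ccontr)
    assume "F \<inter> R \<noteq> {}"
    then obtain D t where "(D, t) \<in> P" "{t, \<delta> D t} \<in> F" by (auto simp: R_def r_def insert_commute)
    then show False using FT PD by blast
  qed
  have fF: "finite F" "finite R" using finite_subset[OF FE(1) fE] finite_subset[OF RE(1) fE] by auto
  have cR: "card R = card P" by (simp add: R_def card_image inj_r)
  have cE: "card ?E = card F + card P" using FR fF cR by (simp add: card_Un_disjoint)
  have W0: "?W \<noteq> {}" using three neD by fastforce
  have small: "forest (F \<union> R')" if "R' \<subseteq> R" "card R' \<le> 3" for R'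
  proof -
    have "finite R'" using finite_subset[OF that(1) fF(2)] .
    then show ?thesis using that
    proof (induction)
      case (insert e R')
      have c2: "card R' \<le> 2" using insert by simp
      obtain D t where Dt: "(D, t) \<in> P" "e = {\<delta> D t, t}" using insert.prems by (auto simp: R_def r_def)
      have R': "\<exists>D s. (D, s) \<in> P \<and> (a = \<delta> D s \<and> b = s \<or> a = s \<and> b = \<delta> D s) \<and> {\<delta> D s, s} \<in> R'"
        if ab: "{a, b} \<in> R'" for a b
      proof -
        have "{a, b} \<in> r ` P" using ab insert.prems(1) by (auto simp: R_def)
        then obtain D s where Ds: "(D, s) \<in> P" "{a, b} = {\<delta> D s, s}" by (auto simp: r_def)
        then have "{\<delta> D s, s} \<in> R'" using ab by simp
        moreover have "a = \<delta> D s \<and> b = s \<or> a = s \<and> b = \<delta> D s"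
          using Ds(2) by (simp only: doubleton_eq_iff)
        ultimately have "{\<delta> D s, s} \<in> R'" "a = \<delta> D s \<and> b = s \<or> a = s \<and> b = \<delta> D s" .
        then show ?thesis using Ds(1) by blast
      qed
      have "\<not> reach (F \<union> R') (\<delta> D t) t"
      proof
        assume rch: "reach (F \<union> R') (\<delta> D t) t"
        then have rch': "reach (F \<union> R') t (\<delta> D t)" by (simp add: reach_sym)
        \<comment> \<open>The edge for (D, t) can close a cycle only if both t and D have another
          contact in \<open>R'\<close>. With at most two contacts there, these are one from t to
          some C and one from D to some s, and then \<open>insert t C\<close> is closed under all
          edges, so D is not reached from t.\<close>
        consider "\<forall>C. (C, t) \<in> P \<longrightarrow> {\<delta> C t, t} \<notin> R'" | "\<forall>s. (D, s) \<in> P \<longrightarrow> {\<delta> D s, s} \<notin> R'"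
          | C s where "(C, t) \<in> P" "{\<delta> C t, t} \<in> R'" "(D, s) \<in> P" "{\<delta> D s, s} \<in> R'" by blast
        then show False
        proof cases
          case 1
          have "\<delta> D t \<in> {t}"
          proof (rule reach_closed[OF rch'])
            fix a b assume "{a, b} \<in> F \<union> R'" "a \<in> {t}"
            then show "b \<in> {t}" using 1 R'[of a b] FT[of a b] \<delta>T PD[OF Dt(1)] by auto
          qed auto
          then show False using \<delta>T[OF Dt(1)] PD[OF Dt(1)] by auto
        next
          case 2
          have "t \<in> D"
          proof (rule reach_closed[OF rch])
            fix a b assume ab: "{a, b} \<in> F \<union> R'" and a: "a \<in> D"
            show "b \<in> D"
            proof (cases "{a, b} \<in> F")
              case False
              then obtain C s where C: "(C, s) \<in> P" "a = \<delta> C s \<and> b = s \<or> a = s \<and> b = \<delta> C s"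
                "{\<delta> C s, s} \<in> R'" using R' ab by blast
              have "a \<notin> T" using a DV PD[OF Dt(1)] by auto
              then have "a = \<delta> C s" using C PD by auto
              then have "C = D" using a \<delta>(1)[OF C(1)] disj[of C D] PD[OF C(1)] PD[OF Dt(1)] by auto
              then show ?thesis using 2 C by auto
            qed (use Fin a PD[OF Dt(1)] in auto)
          qed (use \<delta> Dt in auto)
          then show False using DV PD[OF Dt(1)] by auto
        next
          case 3
          have CD: "C \<noteq> D" "s \<noteq> t" using 3 insert.hyps(2) Dt by auto
          then have CD0: "C \<inter> D = {}" using disj PD 3 by metis
          have ne: "{\<delta> C t, t} \<noteq> {\<delta> D s, s}" using uniq[OF 3(1) 3(3)] CD by auto
          have "{{\<delta> C t, t}, {\<delta> D s, s}} = R'"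
            by (rule card_seteq) (use 3 ne c2 insert.hyps(1) in auto)
          then have R2: "\<And>e. e \<in> R' \<Longrightarrow> e = {\<delta> C t, t} \<or> e = {\<delta> D s, s}" by auto
          have "\<delta> D t \<in> insert t C"
          proof (rule reach_closed[OF rch'])
            fix a b assume ab: "{a, b} \<in> F \<union> R'" and a: "a \<in> insert t C"
            show "b \<in> insert t C"
            proof (cases "{a, b} \<in> F")
              case True
              then show ?thesis using FT[OF True] Fin[OF True] a PD[OF 3(1)] by auto
            next
              case False
              then have "{a, b} = {\<delta> C t, t} \<or> {a, b} = {\<delta> D s, s}" using R2 ab by blast
              then show ?thesis
              proof
                assume "{a, b} = {\<delta> D s, s}"
                moreover have "\<delta> D s \<notin> insert t C" using \<delta>(1)[OF 3(3)] CD0 \<delta>T[OF 3(3)] PD[OF 3(1)] by auto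
                moreover have "s \<notin> insert t C" using CD PD[OF 3(3)] PD[OF 3(1)] DV by auto
                ultimately show ?thesis using a by (metis insertI1 insert_commute singletonD insertE)
              qed (use \<delta>(1)[OF 3(1)] in \<open>auto simp: doubleton_eq_iff\<close>)
            qed
          qed auto
          then show False using \<delta>(1)[OF Dt(1)] CD0 \<delta>T[OF Dt(1)] PD[OF Dt(1)] by auto
        qed
      qed
      moreover have "forest (F \<union> R')" using insert by simp
      ultimately show ?case using forest_insert Dt(2) by fastforce
    qed (simp add: F(2))
  qed
  show ?thesis
  proof (cases "forest ?E")
    case True
    have "card (reach_class ?W ?E ` ?W) \<noteq> 0" using W0 fW by simp
    then have "card P + 1 \<le> card T + card \<D>"
      using forest_card[OF sg True] cE cF by linarith
    \<comment> \<open>With k = |T| + |\<D>| at least 3, a forest has at most k - 1 contacts, and k +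
      3 is at most 2k.\<close>
    then have "card P + 4 \<le> 2 * (card T + card \<D>)" using three by presburger
    then show ?thesis unfolding cP[symmetric] .
  next
    case False
    obtain p g where "plane_drawing V E p g" using planar by (auto simp: planar_def)
    moreover have "?E \<subseteq> E" using FE(1) RE(1) by (rule Un_least)
    moreover have "\<And>e. e \<in> ?E \<Longrightarrow> e \<subseteq> ?W" using sg unfolding simple_graph_def by (elim conjE) simp
    ultimately have "plane_drawing ?W ?E p g"
      by (rule plane_drawing_subgraph[OF _ WV])
    then interpret plane_graph ?W ?E p g by (rule plane_graph.intro[OF sg])
    obtain Y Q where Y: "finite (Y :: complex set)" "card ?E + 2 \<le> card Y + card ?W"
      "\<And>e. e \<in> ?E \<Longrightarrow> card {y \<in> Y. Q y e} \<le> 2" "\<And>y. y \<in> Y \<Longrightarrow> \<not> forest {e \<in> ?E. Q y e}"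
      by (rule face_count[OF W0 False]) (rule that)
    have four: "4 \<le> card {e \<in> R. Q y e}" if "y \<in> Y" for y
    proof (rule ccontr)
      assume "\<not> 4 \<le> card {e \<in> R. Q y e}"
      then have "forest (F \<union> {e \<in> R. Q y e})" by (intro small) auto
      then have "forest {e \<in> ?E. Q y e}" by (rule forest_subset) auto
      then show False using Y(4) that by blast
    qed
    have "4 * card Y \<le> (\<Sum>y\<in>Y. card {e \<in> R. Q y e})"
      using sum_bounded_below[of Y 4 "\<lambda>y. card {e \<in> R. Q y e}"] four by (simp add: mult.commute)
    also have "\<dots> = (\<Sum>e\<in>R. card {y \<in> Y. Q y e})"
      by (rule sum_card_swap) (use Y fF in auto)
    also have "\<dots> \<le> 2 * card R"
      using sum_bounded_above[of R "\<lambda>e. card {y \<in> Y. Q y e}" 2] Y(3) by (simp add: mult.commute)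
    finally have "4 * card Y \<le> 2 * card P" using cR by simp
    \<comment> \<open>Put k = |T| + |\<D>|. The forest has |W| - k edges for W the vertex set, so
      the face count gives |P| + 2 \<le> |Y| + k. Doubling this and using 2|Y| \<le> |P| yields the
      bound.\<close>
    then have "card P + 4 \<le> 2 * (card T + card \<D>)" using Y(2) cE cF by presburger
    then show ?thesis unfolding cP[symmetric] .
  qed
qed

section \<open>The theorems of Hall and Tutte\<close>

text \<open>Induction on the number of sets. If every proper nonempty subfamily has a surplus, one
  value can be assigned freely. Otherwise a tight subfamily \<open>J\<close> is served on its own,
  and the other sets keep Hall's condition after losing its values, because adding \<open>J\<close>
  back uses up exactly the removed ones.\<close>

theorem hall_marriage:
  fixes A :: "'i \<Rightarrow> 'b set"
  assumes "finite I" "\<And>i. i \<in> I \<Longrightarrow> finite (A i)"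
    and "\<And>J. J \<subseteq> I \<Longrightarrow> card J \<le> card (\<Union>(A ` J))"
  shows "\<exists>f. inj_on f I \<and> (\<forall>i\<in>I. f i \<in> A i)"
  using assms
proof (induction "card I" arbitrary: I A rule: less_induct)
  case less
  note fI = less.prems(1) and fA = less.prems(2) and H = less.prems(3)
  have fU: "finite (\<Union>(A ` J))" if "J \<subseteq> I" for J
    using that fA finite_subset[OF that fI] by auto
  consider "I = {}" | "I \<noteq> {}" "\<forall>J. J \<noteq> {} \<and> J \<subset> I \<longrightarrow> card J < card (\<Union>(A ` J))"
    | J where "J \<noteq> {}" "J \<subset> I" "card (\<Union>(A ` J)) \<le> card J"
    by (meson not_le_imp_less)
  then show ?case
  proof cases
    case 1
    then show ?thesis by simp
  next
    case 2
    then obtain i where i: "i \<in> I" by auto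
    have "card {i} \<le> card (A i)" using H[of "{i}"] i by simp
    then obtain b where b: "b \<in> A i" by fastforce
    let ?I = "I - {i}" let ?A = "\<lambda>j. A j - {b}"
    have "\<exists>f. inj_on f ?I \<and> (\<forall>j\<in>?I. f j \<in> ?A j)"
    proof (rule less.hyps)
      show "card ?I < card I" using fI i by (rule card_Diff1_less)
      show "card J \<le> card (\<Union>(?A ` J))" if J: "J \<subseteq> ?I" for J
      proof (cases "J = {}")
        case False
        have "J \<subset> I" using J i by auto
        then have "card J < card (\<Union>(A ` J))" using 2 False by blast
        moreover have "\<Union>(?A ` J) = \<Union>(A ` J) - {b}" by auto
        moreover have "card (\<Union>(A ` J)) - 1 \<le> card (\<Union>(A ` J) - {b})"
          by (metis diff_card_le_card_Diff card.empty card_insert_disjoint empty_iff finite.emptyI finite_insert One_nat_def)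
        ultimately show ?thesis by simp
      qed simp
    qed (use fI fA in auto)
    then obtain f where f: "inj_on f ?I" "\<forall>j\<in>?I. f j \<in> ?A j" by blast
    have "inj_on (f(i := b)) I"
      using f by (auto simp: inj_on_def)
    moreover have "\<forall>j\<in>I. (f(i := b)) j \<in> A j" using f b by auto
    ultimately show ?thesis by blast
  next
    case 3
    let ?B = "\<Union>(A ` J)" let ?K = "I - J" let ?A = "\<lambda>j. A j - ?B"
    have JI: "J \<subseteq> I" and fJ: "finite J" using 3(2) fI finite_subset by auto
    have "\<exists>f. inj_on f J \<and> (\<forall>j\<in>J. f j \<in> A j)"
    proof (rule less.hyps)
      show "card J < card I" using psubset_card_mono[OF fI 3(2)] .
      show "card K \<le> card (\<Union>(A ` K))" if "K \<subseteq> J" for K using H that JI by auto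
    qed (use fJ fA JI in auto)
    then obtain f where f: "inj_on f J" "\<forall>j\<in>J. f j \<in> A j" by blast
    have "\<exists>h. inj_on h ?K \<and> (\<forall>j\<in>?K. h j \<in> ?A j)"
    proof (rule less.hyps)
      show "card ?K < card I" using 3 fI JI by (intro psubset_card_mono) auto
      show "card L \<le> card (\<Union>(?A ` L))" if L: "L \<subseteq> ?K" for L
      proof -
        have "finite L" using L fI finite_subset by blast
        then have "card L + card J = card (L \<union> J)"
          using L fJ by (subst card_Un_disjoint) auto
        also have "\<dots> \<le> card (\<Union>(A ` (L \<union> J)))" using L JI by (intro H) auto
        also have "\<dots> \<le> card (\<Union>(?A ` L)) + card ?B"
        proof -
          have "\<Union>(A ` (L \<union> J)) \<subseteq> \<Union>(?A ` L) \<union> ?B" by auto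
          moreover have "finite (\<Union>(?A ` L) \<union> ?B)"
            using fU[of L] fU[OF JI] L by (auto intro: finite_subset[of "\<Union>(?A ` L)" "\<Union>(A ` L)"])
          ultimately have "card (\<Union>(A ` (L \<union> J))) \<le> card (\<Union>(?A ` L) \<union> ?B)"
            by (intro card_mono)
          also note card_Un_le
          finally show ?thesis .
        qed
        finally show ?thesis using 3(3) by simp
      qed
    qed (use fI fA in auto)
    then obtain h where h: "inj_on h ?K" "\<forall>j\<in>?K. h j \<in> ?A j" by blast
    let ?f = "\<lambda>i. if i \<in> J then f i else h i"
    have "inj_on ?f I"
    proof (rule inj_onI)
      fix x y assume xy: "x \<in> I" "y \<in> I" "?f x = ?f y"
      have ne: "f i \<noteq> h j" if "i \<in> J" "j \<in> ?K" for i j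
        using f(2) h(2) that by auto
      show "x = y"
      proof (cases "x \<in> J"; cases "y \<in> J")
        assume "x \<in> J" "y \<in> J"
        then show ?thesis using xy(3) inj_onD[OF f(1)] by simp
      next
        assume "x \<in> J" "y \<notin> J"
        then show ?thesis using ne[of x y] xy by simp
      next
        assume "x \<notin> J" "y \<in> J"
        then show ?thesis using ne[of y x] xy by simp
      next
        assume "x \<notin> J" "y \<notin> J"
        then show ?thesis using xy inj_onD[OF h(1), of x y] by simp
      qed
    qed
    moreover have "\<forall>i\<in>I. ?f i \<in> A i" using f h by auto
    ultimately show ?thesis by blast
  qed
qed

lemma perfect_matching_Union:
  assumes pm: "\<And>i. i \<in> I \<Longrightarrow> perfect_matching (A i) (induced E (A i)) (M i)"
    and disj: "\<And>i j. i \<in> I \<Longrightarrow> j \<in> I \<Longrightarrow> i \<noteq> j \<Longrightarrow> A i \<inter> A j = {}"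
  shows "perfect_matching (\<Union>i\<in>I. A i) (induced E (\<Union>i\<in>I. A i)) (\<Union>i\<in>I. M i)"
  unfolding perfect_matching_def
proof (intro conjI ballI)
  have sub: "e \<in> E \<and> e \<subseteq> A i" if "i \<in> I" "e \<in> M i" for i e
    using pm[OF that(1)] that(2) by (auto simp: perfect_matching_def induced_def)
  show "(\<Union>i\<in>I. M i) \<subseteq> induced E (\<Union>i\<in>I. A i)"
    using sub unfolding induced_def by blast
  fix v assume "v \<in> (\<Union>i\<in>I. A i)"
  then obtain i where i: "i \<in> I" "v \<in> A i" by auto
  then have "\<exists>!e. e \<in> M i \<and> v \<in> e" using pm by (simp add: perfect_matching_def)
  moreover have "e \<in> M i" if "e \<in> M j" "j \<in> I" "v \<in> e" for e j
    using disj[of i j] sub[of j e] i that by auto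
  ultimately show "\<exists>!e. e \<in> (\<Union>i\<in>I. M i) \<and> v \<in> e"
    using i(1) by (metis UN_iff)
qed

lemma perfect_matching_insert_edge:
  assumes "perfect_matching W (induced E W) M" "{a, b} \<in> E" "a \<notin> W" "b \<notin> W"
  shows "perfect_matching (insert a (insert b W)) (induced E (insert a (insert b W))) (insert {a, b} M)"
  unfolding perfect_matching_def
proof (intro conjI ballI)
  have sub: "e \<in> E \<and> e \<subseteq> W" if "e \<in> M" for e
    using assms(1) that by (auto simp: perfect_matching_def induced_def)
  show "insert {a, b} M \<subseteq> induced E (insert a (insert b W))"
    using sub assms(2) unfolding induced_def by blast
  fix v assume "v \<in> insert a (insert b W)"
  then consider "v \<in> {a, b}" "v \<notin> W" | "v \<in> W" "v \<notin> {a, b}" using assms(3,4) by blast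
  then show "\<exists>!e. e \<in> insert {a, b} M \<and> v \<in> e"
  proof cases
    case 1
    then have "v \<notin> e" if "e \<in> M" for e using sub[OF that] by blast
    then show ?thesis using 1(1) by (intro ex1I[of _ "{a, b}"]) auto
  next
    case 2
    then have "\<exists>!e. e \<in> M \<and> v \<in> e" using assms(1) by (simp add: perfect_matching_def)
    then show ?thesis using 2(2) by (metis insert_iff)
  qed
qed

lemma odd_comps_Diff:
  assumes "D \<in> comps E W" "X \<subseteq> D" "finite W"
  shows "card (odd_comps E (W - X)) = card (odd_comps E W - {D}) + card (odd_comps E (D - X))"
proof -
  have eq: "odd_comps E (W - X) = (odd_comps E W - {D}) \<union> odd_comps E (D - X)"
    using comps_Diff[OF assms(1,2)] by (auto simp: odd_comps_def)
  have "C \<notin> odd_comps E (D - X)" if "C \<in> odd_comps E W - {D}" for C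
  proof
    assume "C \<in> odd_comps E (D - X)"
    then have "C \<subseteq> D" "C \<noteq> {}" by (auto simp: odd_comps_def comps_def connected_in_def)
    then show False using comps_disjoint[of C E W D] assms(1) that by (auto simp: odd_comps_def)
  qed
  then have "(odd_comps E W - {D}) \<inter> odd_comps E (D - X) = {}" by blast
  moreover have "finite D" using assms finite_subset by (auto simp: comps_def)
  then have "finite (odd_comps E W - {D})" "finite (odd_comps E (D - X))"
    using assms(3) by (simp_all add: odd_comps_def comps_finite)
  ultimately show ?thesis by (simp add: eq card_Un_disjoint)
qed

lemma finite_odd_comps: "finite U \<Longrightarrow> finite (odd_comps E U)"
  by (simp add: odd_comps_def comps_finite)

text \<open>For a largest \<open>S\<close> attaining equality, all components of \<open>U - S\<close> are odd and stay matchable after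
  deletion of any one vertex, and Hall's theorem matches them with \<open>S\<close>.\<close>

theorem tutte_sufficiency:
  assumes "finite U" "\<And>S. S \<subseteq> U \<Longrightarrow> card (odd_comps E (U - S)) \<le> card S"
  shows "\<exists>M. perfect_matching U (induced E U) M"
  using assms
proof (induction "card U" arbitrary: U rule: less_induct)
  case less
  note fU = less.prems(1) and H = less.prems(2)
  have "card (odd_comps E (U - {})) = card ({} :: 'a set)" using H[of "{}"] by simp
  moreover have "card S \<le> card U" if "S \<subseteq> U" for S using that fU by (simp add: card_mono)
  ultimately have "\<exists>S. (S \<subseteq> U \<and> card (odd_comps E (U - S)) = card S) \<and>
      (\<forall>S'. S' \<subseteq> U \<and> card (odd_comps E (U - S')) = card S' \<longrightarrow> card S' \<le> card S)"
    by (intro ex_has_greatest_nat[of _ "{}" _ "Suc (card U)"]) (auto simp: less_Suc_eq_le)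
  then obtain S where S: "S \<subseteq> U" "card (odd_comps E (U - S)) = card S"
    "\<And>S'. S' \<subseteq> U \<Longrightarrow> card S' \<le> card (odd_comps E (U - S')) \<Longrightarrow> card S' \<le> card S"
    using H by (metis order_antisym)
  have fS: "finite S" using S(1) fU by (rule finite_subset)
  let ?W = "U - S"
  have fW: "finite ?W" using fU by simp
  have sub: "D \<subseteq> ?W" "finite D" if "D \<in> comps E ?W" for D
    using that fW by (auto simp: comps_def intro: finite_subset)
  \<comment> \<open>Deleting a vertex d from an even component leaves an odd component there, so
    \<open>insert d S\<close> would attain equality as well, against the choice of
    \<open>S\<close>.\<close>
  have all_odd: "odd_comps E ?W = comps E ?W"
  proof (rule ccontr)
    assume "odd_comps E ?W \<noteq> comps E ?W"
    then obtain D where D: "D \<in> comps E ?W" "even (card D)" by (auto simp: odd_comps_def)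
    then have "D \<noteq> {}" by (auto simp: comps_def connected_in_def)
    then obtain d where d: "d \<in> D" by auto
    have "odd (card (D - {d}))"
      using card.remove[OF sub(2)[OF D(1)] d] D(2) by simp
    then obtain C where C: "C \<in> odd_comps E (D - {d})"
      using odd_comp_exists[of "D - {d}" E] sub(2)[OF D(1)] by auto
    have "odd_comps E ?W - {D} = odd_comps E ?W" using D by (auto simp: odd_comps_def)
    then have "card (odd_comps E (?W - {d})) = card S + card (odd_comps E (D - {d}))"
      using odd_comps_Diff[OF D(1) _ fW, of "{d}"] d S(2) by simp
    moreover have "card (odd_comps E (D - {d})) \<noteq> 0"
      using C finite_odd_comps sub(2)[OF D(1)] by (metis card_0_eq empty_iff finite_Diff)
    moreover have "U - insert d S = ?W - {d}" by auto
    moreover have dS: "d \<notin> S" "d \<in> U" using d sub(1)[OF D(1)] by auto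
    ultimately have "card (insert d S) \<le> card (odd_comps E (U - insert d S))" using fS by simp
    then have "card (insert d S) \<le> card S" using S(3)[of "insert d S"] S(1) dS by simp
    then show False using dS fS by simp
  qed
  \<comment> \<open>If X violated the condition for D - {c}, parity would raise the excess to two.
    Then S together with c and X would have at least (|S| - 1) + (|X| + 2) odd components, which is
    its own size, again against the maximality of S.\<close>
  have sub_pm: "\<exists>M. perfect_matching (D - {c}) (induced E (D - {c})) M" if D: "D \<in> comps E ?W" "c \<in> D" for D c
  proof (rule less.hyps)
    have DU: "D \<subseteq> U" "finite D" using sub[OF D(1)] by auto
    show "card (D - {c}) < card U"
      using DU D(2) fU by (metis card_Diff1_less card_mono order_less_le_trans)
    show "finite (D - {c})" using DU by simp
    fix X assume X: "X \<subseteq> D - {c}"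
    have fX: "finite X" using X DU finite_subset by blast
    show "card (odd_comps E (D - {c} - X)) \<le> card X"
    proof (rule ccontr)
      assume "\<not> ?thesis"
      then have gt: "card (odd_comps E (D - {c} - X)) > card X" by simp
      let ?X = "insert c X"
      have cX: "card ?X = Suc (card X)" using X fX by (auto simp: card_insert_if)
      have XD: "?X \<subseteq> D" using X D(2) by auto
      have "odd (card D)" using D(1) all_odd by (auto simp: odd_comps_def)
      moreover have "card D = card (D - ?X) + card ?X"
        using XD DU by (metis card_Diff_subset card_mono finite_subset le_add_diff_inverse2)
      ultimately have "even (card (D - ?X)) \<longleftrightarrow> even (card X)" using cX by auto
      then have par: "even (card (odd_comps E (D - ?X))) \<longleftrightarrow> even (card X)"
        using odd_comps_parity[of "D - ?X" E] DU by auto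
      have eq: "D - {c} - X = D - ?X" by auto
      have "card (odd_comps E (D - ?X)) \<noteq> card X + 1" using par by auto
      then have "card (odd_comps E (D - ?X)) \<ge> card X + 2" using gt unfolding eq by linarith
      moreover have "card (odd_comps E ?W - {D}) = card S - 1"
        using D(1) all_odd S(2) finite_odd_comps[OF fW, of E] by simp
      moreover have "card S \<noteq> 0"
        using D(1) all_odd S(2) finite_odd_comps[OF fW, of E] by (metis card_0_eq empty_iff)
      ultimately have "card S + card ?X \<le> card (odd_comps E (?W - ?X))"
        using odd_comps_Diff[OF D(1) XD fW] cX by linarith
      moreover have "U - (S \<union> ?X) = ?W - ?X" by auto
      moreover have cSX: "card (S \<union> ?X) = card S + card ?X"
        using XD sub(1)[OF D(1)] fS fX by (intro card_Un_disjoint) auto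
      moreover have "S \<union> ?X \<subseteq> U" using S(1) XD DU(1) by blast
      ultimately have "card (S \<union> ?X) \<le> card S" using S(3)[of "S \<union> ?X"] by metis
      then show False using cSX cX by linarith
    qed
  qed
  let ?C = "comps E ?W"
  have fC: "finite ?C" using fW by (rule comps_finite)
  have "\<exists>f. inj_on f ?C \<and> (\<forall>D\<in>?C. f D \<in> nbr E D \<inter> S)"
  proof (rule hall_marriage[OF fC])
    fix J assume J: "J \<subseteq> ?C"
    \<comment> \<open>The components in \<open>J\<close> have no neighbours outside
      \<open>?N\<close>, so they remain odd components after deleting \<open>?N\<close> alone: the
      assumption on deleted sets, applied to \<open>?N\<close>, is Hall's condition for
      \<open>J\<close>.\<close>
    let ?N = "\<Union>D\<in>J. nbr E D \<inter> S"
    have "D \<in> odd_comps E (U - ?N)" if "D \<in> J" for D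
    proof -
      have "D \<in> ?C" using that J by auto
      then have "D \<subseteq> U - ?N" "connected_in E D" "nbr E D \<inter> ?W = {}" "odd (card D)"
        using all_odd by (auto simp: comps_def odd_comps_def)
      then show ?thesis using that by (auto simp: comps_def odd_comps_def)
    qed
    then have "card J \<le> card (odd_comps E (U - ?N))"
      using fU by (intro card_mono finite_odd_comps finite_Diff) auto
    also have "\<dots> \<le> card ?N" using S(1) by (intro H) auto
    finally show "card J \<le> card ?N" .
  qed (use fS in auto)
  then obtain f where f: "inj_on f ?C" "\<And>D. D \<in> ?C \<Longrightarrow> f D \<in> nbr E D \<inter> S" by blast
  have fimg: "f ` ?C = S"
    using f fS S(2) all_odd by (intro card_seteq) (auto simp: card_image)
  have "\<exists>c\<in>D. {c, f D} \<in> E" if "D \<in> ?C" for D using f(2)[OF that] by (auto simp: nbr_def)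
  then obtain c where c: "\<And>D. D \<in> ?C \<Longrightarrow> c D \<in> D" "\<And>D. D \<in> ?C \<Longrightarrow> {c D, f D} \<in> E" by metis
  have "\<exists>M. perfect_matching (insert (f D) D) (induced E (insert (f D) D)) M" if D: "D \<in> ?C" for D
  proof -
    obtain M where M: "perfect_matching (D - {c D}) (induced E (D - {c D})) M"
      using sub_pm[OF D c(1)[OF D]] by blast
    have "f D \<notin> D" using f(2)[OF D] by (auto simp: nbr_def)
    then have "perfect_matching (insert (c D) (insert (f D) (D - {c D})))
        (induced E (insert (c D) (insert (f D) (D - {c D})))) (insert {c D, f D} M)"
      using perfect_matching_insert_edge[OF M c(2)[OF D]] by simp
    moreover have "insert (c D) (insert (f D) (D - {c D})) = insert (f D) D"
      using c(1)[OF D] by auto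
    ultimately show ?thesis by metis
  qed
  then obtain M where M: "\<And>D. D \<in> ?C \<Longrightarrow>
      perfect_matching (insert (f D) D) (induced E (insert (f D) D)) (M D)" by metis
  have "insert (f C) C \<inter> insert (f D) D = {}" if CD: "C \<in> ?C" "D \<in> ?C" "C \<noteq> D" for C D
  proof -
    have "f C \<noteq> f D" using CD f(1) by (auto dest: inj_onD)
    moreover have "C \<inter> D = {}" using comps_disjoint CD by blast
    moreover have "f C \<notin> D" "f D \<notin> C" using f(2) sub CD by auto
    ultimately show ?thesis by auto
  qed
  from perfect_matching_Union[of ?C "\<lambda>D. insert (f D) D" E M, OF M this]
  have "perfect_matching (\<Union>D\<in>?C. insert (f D) D) (induced E (\<Union>D\<in>?C. insert (f D) D)) (\<Union>(M ` ?C))" .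
  moreover have "(\<Union>D\<in>?C. insert (f D) D) = U"
  proof -
    have "(\<Union>D\<in>?C. insert (f D) D) = f ` ?C \<union> \<Union>?C" by auto
    then show ?thesis using fimg Union_comps[of E ?W] S(1) by auto
  qed
  ultimately show ?case by auto
qed

section \<open>Parity of matched sets, and degrees as neighbourhood sizes\<close>

lemma perfect_matching_even:
  assumes pm: "perfect_matching U F M" and P: "P \<subseteq> U" "finite P"
    and M: "\<And>e. e \<in> M \<Longrightarrow> card e = 2" "\<And>e. e \<in> M \<Longrightarrow> e \<subseteq> P \<or> e \<inter> P = {}"
  shows "even (card P)"
proof -
  let ?M = "{e \<in> M. e \<subseteq> P}"
  have ex: "\<exists>!e. e \<in> M \<and> v \<in> e" if "v \<in> P" for v
    using pm subsetD[OF P(1) that] by (simp add: perfect_matching_def)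
  have U: "\<Union>?M = P"
  proof
    show "P \<subseteq> \<Union>?M"
    proof
      fix v assume v: "v \<in> P"
      then obtain e where "e \<in> M" "v \<in> e" using ex by blast
      then show "v \<in> \<Union>?M" using M(2)[of e] v by blast
    qed
  qed auto
  have "pairwise disjnt ?M"
  proof (rule pairwiseI)
    fix e f assume "e \<in> ?M" "f \<in> ?M" "e \<noteq> f"
    then show "disjnt e f" using ex unfolding disjnt_def by blast
  qed
  moreover have "finite e" if "e \<in> ?M" for e using that M(1)[of e] by (auto intro: card_ge_0_finite)
  ultimately have "card (\<Union>?M) = (\<Sum>e\<in>?M. card e)" by (intro card_Union_disjoint)
  also have "\<dots> = (\<Sum>e\<in>?M. 2)" using M(1) by (intro sum.cong) auto
  finally show ?thesis unfolding U by simp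
qed

lemma degree_eq_card_nbr:
  assumes "simple_graph V E"
  shows "degree E v = card (nbr E {v})"
proof -
  have "bij_betw (\<lambda>w. {v, w}) (nbr E {v}) {e \<in> E. v \<in> e}"
  proof (rule bij_betw_imageI)
    show "inj_on (\<lambda>w. {v, w}) (nbr E {v})" by (auto simp: inj_on_def doubleton_eq_iff)
    show "(\<lambda>w. {v, w}) ` nbr E {v} = {e \<in> E. v \<in> e}"
    proof
      show "{e \<in> E. v \<in> e} \<subseteq> (\<lambda>w. {v, w}) ` nbr E {v}"
      proof
        fix e assume e: "e \<in> {e \<in> E. v \<in> e}"
        then have "card e = 2" using assms by (auto simp: simple_graph_def)
        then obtain a b where "e = {a, b}" "a \<noteq> b" by (auto simp: card_2_iff)
        then obtain w where "e = {v, w}" "w \<noteq> v" using e by auto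
        then show "e \<in> (\<lambda>w. {v, w}) ` nbr E {v}" using e by (auto simp: nbr_def)
      qed
    qed (auto simp: nbr_def)
  qed
  then show ?thesis by (simp add: degree_def bij_betw_same_card)
qed

section \<open>3-factor-critical graphs\<close>

locale three_critical =
  fixes V :: "'a set" and E :: "'a set set"
  assumes graph: "simple_graph V E" and critical: "factor_critical 3 V E"
begin

lemma finite_V: "finite V" and edge: "e \<in> E \<Longrightarrow> e \<subseteq> V \<and> card e = 2" and large: "3 < card V"
  using graph critical by (auto simp: simple_graph_def factor_critical_def)

lemma edgeD: "{a, b} \<in> E \<Longrightarrow> a \<in> V \<and> b \<in> V \<and> a \<noteq> b"
  using edge[of "{a, b}"] by auto

lemma nbr_subset: "nbr E P \<subseteq> V - P"
  using edgeD by (auto simp: nbr_def)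

lemma finite_nbr: "finite (nbr E P)"
  using finite_subset[OF nbr_subset] finite_V by simp

lemma matching_even:
  assumes S: "S \<subseteq> V" "card S = 3" and P: "P \<subseteq> V - S" "nbr E P \<subseteq> S"
  shows "even (card P)"
proof -
  obtain M where M: "perfect_matching (V - S) {e \<in> E. e \<inter> S = {}} M"
    using critical S by (auto simp: factor_critical_def)
  have ME: "e \<in> E" "e \<inter> S = {}" if "e \<in> M" for e using M that by (auto simp: perfect_matching_def)
  show ?thesis
  proof (rule perfect_matching_even[OF M P(1)])
    show "finite P" using P(1) finite_V finite_subset by blast
    show "card e = 2" if "e \<in> M" for e using edge ME that by blast
    fix e assume e: "e \<in> M"
    then obtain a b where ab: "e = {a, b}" using edge[OF ME(1)[OF e]] by (auto simp: card_2_iff)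
    then have "{b, a} \<in> E" using ME(1)[OF e] by (simp add: insert_commute)
    then show "e \<subseteq> P \<or> e \<inter> P = {}"
      using ab ME[OF e] P(2) by (auto simp: nbr_def)
  qed
qed

lemma odd_V: "odd (card V)"
proof -
  obtain S where S: "S \<subseteq> V" "card S = 3" using large by (meson less_imp_le obtain_subset_with_card_n)
  have "nbr E (V - S) \<subseteq> S" using nbr_subset[of "V - S"] by auto
  then have "even (card (V - S))" using matching_even[OF S] by blast
  moreover have "card V = card (V - S) + 3"
    using S finite_V large by (simp add: card_Diff_subset finite_subset)
  ultimately show ?thesis by simp
qed

text \<open>With at most three neighbours, the neighbourhood could be enlarged to three vertices
  outside \<open>P\<close>, which is why room for three is assumed. Deleting them would isolate an
  odd set.\<close>

lemma odd_nbr: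
  assumes "P \<subseteq> V" "odd (card P)" "3 \<le> card (V - P)"
  shows "4 \<le> card (nbr E P)"
proof (rule ccontr)
  assume "\<not> ?thesis"
  then have "card (nbr E P) \<le> 3" by simp
  then obtain S where S: "nbr E P \<subseteq> S" "S \<subseteq> V - P" "card S = 3"
    using exists_subset_between[of "nbr E P" 3 "V - P"] nbr_subset finite_V assms(3) by auto
  then have "even (card P)" using assms(1) by (intro matching_even[of S]) auto
  then show False using assms(2) by simp
qed

lemma degree_ge: "v \<in> V \<Longrightarrow> 4 \<le> card (nbr E {v})"
  using odd_nbr[of "{v}"] large finite_V by simp

text \<open>An odd \<open>P\<close> even has four neighbours. From an even \<open>P\<close> remove a
  vertex x: the odd rest has at least four neighbours, of which only x is not a neighbour of
  \<open>P\<close>. The room demanded by \<open>odd_nbr\<close> comes from the vertex r beyond,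
  whose neighbours, at least four of them, all avoid \<open>P\<close>.\<close>

lemma three_connected:
  assumes P: "P \<subseteq> V" "P \<noteq> {}" and R: "V - P - nbr E P \<noteq> {}"
  shows "3 \<le> card (nbr E P)"
proof (rule ccontr)
  assume n: "\<not> ?thesis"
  have fP: "finite P" using P finite_V finite_subset by blast
  obtain r where r: "r \<in> V" "r \<notin> P" "r \<notin> nbr E P" using R by auto
  have "nbr E {r} \<subseteq> V - P - {r}"
  proof
    fix w assume "w \<in> nbr E {r}"
    then have w: "{r, w} \<in> E" "w \<noteq> r" "w \<in> V" using edgeD by (auto simp: nbr_def)
    then have "{w, r} \<in> E" by (simp add: insert_commute)
    then show "w \<in> V - P - {r}" using r w by (auto simp: nbr_def)
  qed
  then have "card (nbr E {r}) \<le> card (V - P - {r})" using finite_V by (intro card_mono) auto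
  then have "4 \<le> card (V - P - {r})" using degree_ge[OF r(1)] by linarith
  also have "\<dots> \<le> card (V - P)" using finite_V by (intro card_mono) auto
  finally have VP: "4 \<le> card (V - P)" .
  show False
  proof (cases "odd (card P)")
    case True
    then show False using odd_nbr[OF P(1)] VP n by simp
  next
    case False
    obtain x where x: "x \<in> P" using P by auto
    let ?P = "P - {x}"
    have "odd (card ?P)" using False card.remove[OF fP x] by simp
    moreover have "card (V - P) \<le> card (V - ?P)" using finite_V by (intro card_mono) auto
    ultimately have "4 \<le> card (nbr E ?P)" using odd_nbr[of ?P] P(1) VP by force
    also have "\<dots> \<le> card (insert x (nbr E P))"
      using finite_nbr by (intro card_mono) (auto simp: nbr_def)
    also have "\<dots> \<le> Suc (card (nbr E P))" by (rule card_insert_le_m1[THEN order_trans]) auto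
    finally show False using n by simp
  qed
qed

text \<open>The union and the intersection of the two neighbourhoods on the left are contained in
  those of the two on the right.\<close>

lemma nbr_submodular:
  "card (nbr E (P \<inter> Q)) + card (nbr E (P \<union> Q)) \<le> card (nbr E P) + card (nbr E Q)"
proof -
  have "card (nbr E (P \<inter> Q)) + card (nbr E (P \<union> Q)) =
      card (nbr E (P \<inter> Q) \<union> nbr E (P \<union> Q)) + card (nbr E (P \<inter> Q) \<inter> nbr E (P \<union> Q))"
    by (rule card_Un_Int) (rule finite_nbr)+
  also have "\<dots> \<le> card (nbr E P \<union> nbr E Q) + card (nbr E P \<inter> nbr E Q)"
    using finite_nbr by (intro add_mono card_mono) (auto simp: nbr_def)
  also have "\<dots> = card (nbr E P) + card (nbr E Q)"
    by (rule card_Un_Int[symmetric]) (rule finite_nbr)+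
  finally show ?thesis .
qed

text \<open>\<open>T\<close> consists of a deleted triple and a Tutte set X of what remains. Parity
  makes the number of odd components exceed |X| by two, and |T| = |X| + 3 then leaves the slack of
  one.\<close>

definition barrier :: "'a set \<Rightarrow> 'a set \<Rightarrow> bool" where
  "barrier e T \<longleftrightarrow> T \<subseteq> V \<and> 3 \<le> card T \<and> card T \<le> card (odd_comps (E - {e}) (V - T)) + 1"

lemma nbr_component:
  assumes D: "D \<in> comps (E - {e}) (V - T)" and w: "w \<in> nbr E D" "w \<notin> T"
  shows "\<exists>d\<in>D. {d, w} = e"
proof -
  obtain d where d: "d \<in> D" "{d, w} \<in> E" "w \<notin> D" using w by (auto simp: nbr_def)
  have "w \<in> V - T" using edgeD[OF d(2)] w by simp
  then have "w \<notin> nbr (E - {e}) D" using D by (auto simp: comps_def)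
  then show ?thesis using d by (auto simp: nbr_def)
qed

end

lemma barrier_exists:
  assumes graph: "simple_graph V E" and min: "minimal_factor_critical 3 V E" and e: "e \<in> E"
  obtains T where "T \<subseteq> V" "3 \<le> card T" "card T \<le> card (odd_comps (E - {e}) (V - T)) + 1"
proof -
  interpret three_critical V E
    using graph min by unfold_locales (auto simp: minimal_factor_critical_def)
  let ?E = "E - {e}"
  have "\<not> factor_critical 3 V ?E" using min e by (auto simp: minimal_factor_critical_def)
  then obtain S where S: "S \<subseteq> V" "card S = 3" "\<And>M. \<not> perfect_matching (V - S) {f \<in> ?E. f \<inter> S = {}} M"
    using large by (auto simp: factor_critical_def)
  have "{f \<in> ?E. f \<inter> S = {}} = induced ?E (V - S)"
    using edge by (auto simp: induced_def)
  then have "\<not> (\<exists>M. perfect_matching (V - S) (induced ?E (V - S)) M)" using S(3) by simp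
  then obtain X where X: "X \<subseteq> V - S" "card X < card (odd_comps ?E (V - S - X))"
    using tutte_sufficiency[of "V - S" ?E] finite_V by (metis finite_Diff not_le)
  let ?T = "S \<union> X"
  have fin: "finite S" "finite X" using S X finite_V by (auto intro: finite_subset)
  have T: "?T \<subseteq> V" using S X by auto
  have cT: "card ?T = 3 + card X" using S X fin by (subst card_Un_disjoint) auto
  have "card V = card (V - ?T) + card ?T"
    using T finite_V by (metis card_Diff_subset card_mono finite_subset le_add_diff_inverse2)
  then have "odd (card (V - ?T)) \<longleftrightarrow> odd (card X)" using odd_V cT by auto
  moreover have "V - S - X = V - ?T" by auto
  \<comment> \<open>Since |V| is odd and |T| = 3 + |X|, the number of odd components has the parity
    of |X|, so exceeding |X| means exceeding it by two.\<close>
  ultimately have "odd (card (odd_comps ?E (V - ?T))) \<longleftrightarrow> odd (card X)"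
    "card X < card (odd_comps ?E (V - ?T))"
    using odd_comps_parity[of "V - ?T" ?E] finite_V X(2) by auto
  then have "card X + 2 \<le> card (odd_comps ?E (V - ?T))"
    by (metis Suc_leI add_2_eq_Suc' even_Suc le_neq_implies_less)
  then show ?thesis using that[OF T] cT by simp
qed

section \<open>Barriers in planar graphs\<close>

locale planar_critical = three_critical +
  assumes planar: "planar V E"
begin

text \<open>An odd component has at least four neighbours and an even one at least three. Let t =
  |T|, let q and o count all components and the odd ones, and let s be the sum of the
  \<open>?\<epsilon> D\<close>, the neighbours outside T. The lower bound and the contact bound give
  q + o \<le> 2t - 4 + s, and t \<le> o + 1 turns this into q - o + 2 \<le> s. As only the ends of
  the edge contribute, s \<le> 2, so every inequality is tight.\<close>

lemma barrier_structure:
  assumes e: "{u, v} \<in> E" and T: "barrier {u, v} T"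
  defines "\<D> \<equiv> comps (E - {{u, v}}) (V - T)"
  shows "card \<D> + 1 = card T" "\<And>D. D \<in> \<D> \<Longrightarrow> odd (card D)" "\<And>D. D \<in> \<D> \<Longrightarrow> card (nbr E D) = 4"
    "\<exists>C D. C \<in> \<D> \<and> D \<in> \<D> \<and> u \<in> C \<and> v \<in> D \<and> C \<noteq> D \<and>
      card (nbr E C \<inter> T) = 3 \<and> card (nbr E D \<inter> T) = 3"
proof -
  let ?E = "E - {{u, v}}"
  let ?\<epsilon> = "\<lambda>D. card (nbr E D - T)" and ?a = "\<lambda>D. card (nbr E D \<inter> T)"
  have TV: "T \<subseteq> V" "3 \<le> card T" "card T \<le> card (odd_comps ?E (V - T)) + 1"
    using T by (auto simp: barrier_def)
  have fT: "finite T" using finite_subset[OF TV(1) finite_V] .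
  have fD: "finite \<D>" unfolding \<D>_def using finite_V by (intro comps_finite) simp
  have sub: "D \<subseteq> V - T" "finite D" "D \<noteq> {}" if "D \<in> \<D>" for D
  proof -
    show "D \<subseteq> V - T" using that by (simp add: \<D>_def comps_def)
    then show "finite D" using finite_V finite_subset by blast
    show "D \<noteq> {}" using that by (simp add: \<D>_def comps_def connected_in_def)
  qed
  have VD: "3 \<le> card (V - D)" if "D \<in> \<D>" for D
  proof -
    have "T \<subseteq> V - D" using sub(1)[OF that] TV(1) by auto
    then have "card T \<le> card (V - D)" using finite_V by (intro card_mono) auto
    then show ?thesis using TV(2) by simp
  qed
  have a\<epsilon>: "card (nbr E D) = ?a D + ?\<epsilon> D" for D
    using card_Un_disjoint[of "nbr E D \<inter> T" "nbr E D - T"] finite_nbr[of D]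
    by (simp add: Int_Diff_Un Int_Diff_disjoint)
  have low: "(if odd (card D) then 4 else 3) \<le> card (nbr E D)" if D: "D \<in> \<D>" for D
  proof (cases "odd (card D)")
    case True
    then show ?thesis using odd_nbr[OF _ True VD[OF D]] sub[OF D] by auto
  next
    case False
    show ?thesis
    proof (cases "V - D - nbr E D = {}")
      case True
      then have "V - D \<subseteq> nbr E D" by auto
      then have "card (V - D) \<le> card (nbr E D)" using finite_nbr by (rule card_mono[rotated])
      then show ?thesis using VD[OF D] False by simp
    next
      case False
      then show ?thesis using three_connected[of D] sub[OF D] \<open>\<not> odd (card D)\<close> by auto
    qed
  qed
  have "(\<Sum>D\<in>\<D>. if odd (card D) then 4 else 3 :: nat) = 3 * card \<D> + card (odd_comps ?E (V - T))"
  proof -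
    have "(\<Sum>D\<in>\<D>. if odd (card D) then 4 else 3 :: nat) = (\<Sum>D\<in>\<D>. 3 + (if odd (card D) then 1 else 0))"
      by (intro sum.cong) auto
    also have "\<dots> = 3 * card \<D> + card {D \<in> \<D>. odd (card D)}"
      using fD by (simp add: sum.distrib sum.If_cases Int_def)
    finally show ?thesis by (simp add: odd_comps_def \<D>_def)
  qed
  moreover have "(\<Sum>D\<in>\<D>. if odd (card D) then 4 else 3) \<le> (\<Sum>D\<in>\<D>. card (nbr E D))"
    by (rule sum_mono) (rule low)
  ultimately have lower: "3 * card \<D> + card (odd_comps ?E (V - T)) \<le> (\<Sum>D\<in>\<D>. card (nbr E D))"
    by simp
  have split: "(\<Sum>D\<in>\<D>. card (nbr E D)) = (\<Sum>D\<in>\<D>. ?a D) + (\<Sum>D\<in>\<D>. ?\<epsilon> D)"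
    by (simp add: a\<epsilon> sum.distrib)
  have disj: "C \<inter> D = {}" if "C \<in> \<D>" "D \<in> \<D>" "C \<noteq> D" for C D
    using that comps_disjoint unfolding \<D>_def by blast
  have ole: "card (odd_comps ?E (V - T)) \<le> card \<D>"
    unfolding \<D>_def using fD by (intro card_mono) (auto simp: odd_comps_def \<D>_def)
  have upper: "(\<Sum>D\<in>\<D>. ?a D) + 4 \<le> 2 * (card T + card \<D>)"
  proof (rule planar_contact_bound[OF graph planar TV(1) sub(1) _ disj])
    show "connected_in E D" if "D \<in> \<D>" for D
      using that by (auto simp: \<D>_def comps_def intro: connected_in_mono)
    show "3 \<le> card T + card \<D>" using TV(2) by simp
  qed
  \<comment> \<open>Otherwise no component has a neighbour outside T, so s = 0, which contradicts s
    \<ge> 2.\<close>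
  have sep: "\<exists>C D. C \<in> \<D> \<and> D \<in> \<D> \<and> u \<in> C \<and> v \<in> D \<and> C \<noteq> D"
  proof (rule ccontr)
    assume no: "\<not> ?thesis"
    have "?\<epsilon> D = 0" if D: "D \<in> \<D>" for D
    proof -
      have "w \<in> T" if w: "w \<in> nbr E D" for w
      proof (rule ccontr)
        assume wT: "w \<notin> T"
        obtain d where d: "d \<in> D" "{d, w} = {u, v}"
          using nbr_component[OF D[unfolded \<D>_def] w wT] by blast
        have wD: "w \<notin> D" "w \<in> V" using w nbr_subset by (auto simp: nbr_def)
        then obtain D' where D': "D' \<in> \<D>" "w \<in> D'" using Union_comps[of ?E "V - T"] wT unfolding \<D>_def by blast
        have "D \<noteq> D'" using wD D' by auto
        moreover have "d = u \<and> w = v \<or> d = v \<and> w = u" using d(2) by (simp only: doubleton_eq_iff)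
        ultimately show False using no d(1) D D' by metis
      qed
      then have eq: "nbr E D - T = {}" by auto
      show ?thesis unfolding eq by simp
    qed
    then have "(\<Sum>D\<in>\<D>. ?\<epsilon> D) = 0" by simp
    then show False using lower upper split ole TV(3) by presburger
  qed
  then obtain C D where CD: "C \<in> \<D>" "D \<in> \<D>" "u \<in> C" "v \<in> D" "C \<noteq> D" by blast
  then have "v \<notin> C" "u \<notin> D" using disj[OF CD(1,2,5)] by auto
  have uvT: "u \<notin> T" "v \<notin> T" using sub(1) CD by auto
  have out: "nbr E B - T \<subseteq> (if B = C then {v} else if B = D then {u} else {})" if B: "B \<in> \<D>" for B
  proof
    fix w assume w: "w \<in> nbr E B - T"
    then obtain d where d: "d \<in> B" "{d, w} = {u, v}"
      using nbr_component[of B "{u, v}" T w] B unfolding \<D>_def by blast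
    then have "d = u \<and> w = v \<or> d = v \<and> w = u" by (simp only: doubleton_eq_iff)
    then show "w \<in> (if B = C then {v} else if B = D then {u} else {})"
      using d(1) disj[of B C] disj[of B D] B CD by auto
  qed
  have \<epsilon>le: "?\<epsilon> B \<le> (if B = C then 1 else 0) + (if B = D then 1 else 0)" if B: "B \<in> \<D>" for B
    using card_mono[OF _ out[OF B]] by (cases "B = C"; cases "B = D") auto
  have "(\<Sum>B\<in>\<D>. ?\<epsilon> B) \<le> (\<Sum>B\<in>\<D>. (if B = C then 1 else 0) + (if B = D then 1 else 0))"
    by (intro sum_mono \<epsilon>le)
  also have "\<dots> = 2" using fD CD by (simp add: sum.distrib)
  finally have \<epsilon>2: "(\<Sum>B\<in>\<D>. ?\<epsilon> B) \<le> 2" .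
  have oD: "card (odd_comps ?E (V - T)) = card \<D>"
    using lower upper split ole TV(3) \<epsilon>2 by presburger
  have q: "card \<D> + 1 = card T"
    using lower upper split ole TV(3) \<epsilon>2 by presburger
  have "2 * (card T + card \<D>) = 4 * card \<D> + 2" unfolding q[symmetric] by simp
  then have tot: "(\<Sum>B\<in>\<D>. card (nbr E B)) \<le> 4 * card \<D>"
    using upper \<epsilon>2 unfolding split by linarith
  show "card \<D> + 1 = card T" by (rule q)
  have "odd_comps ?E (V - T) = \<D>"
    using oD fD unfolding \<D>_def by (intro card_subset_eq) (auto simp: odd_comps_def)
  then show odd: "odd (card D)" if "D \<in> \<D>" for D using that by (auto simp: odd_comps_def)
  have four: "4 \<le> card (nbr E D)" if "D \<in> \<D>" for D using low[OF that] odd[OF that] by simp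
  show n4: "card (nbr E B) = 4" if B: "B \<in> \<D>" for B
  proof (rule ccontr)
    assume "card (nbr E B) \<noteq> 4"
    then have "(\<Sum>D\<in>\<D>. 4) < (\<Sum>D\<in>\<D>. card (nbr E D))"
      using four B fD by (intro sum_strict_mono_ex1) (auto simp: order_less_le)
    then show False using tot by simp
  qed
  have "nbr E C - T = {v}" "nbr E D - T = {u}"
  proof -
    have "v \<in> nbr E C" using e CD(3) \<open>v \<notin> C\<close> by (auto simp: nbr_def)
    then show "nbr E C - T = {v}" using out[OF CD(1)] uvT by auto
    have "u \<in> nbr E D" using e CD(4) \<open>u \<notin> D\<close> by (auto simp: nbr_def insert_commute)
    then show "nbr E D - T = {u}" using out[OF CD(2)] uvT CD(5) by auto
  qed
  then have "card (nbr E C \<inter> T) = 3" "card (nbr E D \<inter> T) = 3"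
    using a\<epsilon>[of C] a\<epsilon>[of D] n4 CD(1,2) by simp_all
  then show "\<exists>C D. C \<in> \<D> \<and> D \<in> \<D> \<and> u \<in> C \<and> v \<in> D \<and> C \<noteq> D \<and>
      card (nbr E C \<inter> T) = 3 \<and> card (nbr E D \<inter> T) = 3" using CD by blast
qed

text \<open>Put w back into the graph. If it touches exactly one component, only that one is lost.
  If it touches none or two, it merges with them into a new odd component. In each case at least |T|
  - 2 odd components remain, so T - {w} is a smaller barrier; 4 \<le> |T| keeps its size at least
  three.\<close>

lemma minimal_barrier_degree:
  assumes e: "{u, v} \<in> E" and T: "barrier {u, v} T" and min: "\<And>S. barrier {u, v} S \<Longrightarrow> card T \<le> card S"
    and t: "4 \<le> card T" and w: "w \<in> T"
  shows "3 \<le> card {D \<in> comps (E - {{u, v}}) (V - T). w \<in> nbr E D}"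
proof (rule ccontr)
  let ?E = "E - {{u, v}}" and ?S = "T - {w}"
  let ?D = "comps ?E (V - T)" let ?N = "{D \<in> ?D. w \<in> nbr E D}"
  assume n: "\<not> 3 \<le> card ?N"
  note st = barrier_structure[OF e T]
  have TV: "T \<subseteq> V" using T by (simp add: barrier_def)
  have fT: "finite T" using finite_subset[OF TV finite_V] .
  have fD: "finite ?D" using finite_V by (intro comps_finite) simp
  have "u \<notin> T" "v \<notin> T" using st(4) by (auto simp: comps_def)
  then have nE: "w \<in> nbr E D \<longleftrightarrow> w \<in> nbr ?E D" for D
    using w by (auto simp: nbr_def doubleton_eq_iff)
  have wV: "w \<in> V" using w TV by auto
  have cD: "D \<subseteq> V - T" "connected_in ?E D" "nbr ?E D \<inter> (V - T) = {}" "finite D" if "D \<in> ?D" for D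
    using that finite_V by (auto simp: comps_def intro: finite_subset)
  have keep: "D \<in> odd_comps ?E (V - ?S)" if "D \<in> ?D - ?N" for D
  proof -
    have "w \<notin> nbr ?E D" using that nE by auto
    moreover have mem: "D \<in> ?D" using that by simp
    ultimately have "nbr ?E D \<inter> (V - ?S) = {}" using cD(3)[OF mem] by blast
    moreover have "D \<subseteq> V - ?S" using cD(1)[OF mem] by blast
    ultimately show ?thesis unfolding odd_comps_def comps_def using cD(2)[OF mem] st(2)[OF mem] by simp
  qed
  let ?B = "insert w (\<Union>?N)"
  have dis: "C \<inter> D = {}" if "C \<in> ?D" "D \<in> ?D" "C \<noteq> D" for C D
    using comps_disjoint[OF that] .
  have NB: "nbr ?E ?B \<inter> (V - ?S) = {}"
  proof (rule ccontr)
    assume "nbr ?E ?B \<inter> (V - ?S) \<noteq> {}"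
    then obtain z b where z: "z \<in> V - ?S" "z \<notin> ?B" "b \<in> ?B" "{b, z} \<in> ?E" by (auto simp: nbr_def)
    have zT: "z \<in> V - T" using z by auto
    then obtain D where D: "D \<in> ?D" "z \<in> D" using Union_comps[of ?E "V - T"] by blast
    have DN: "D \<notin> ?N" using z(2) D(2) by auto
    have "{z, b} \<in> ?E" using z(4) by (simp add: insert_commute)
    show False
    proof (cases "b = w")
      case True
      have "w \<in> nbr ?E D" using \<open>{z, b} \<in> ?E\<close> True D cD(1)[OF D(1)] w by (auto simp: nbr_def)
      then show False using DN D nE by auto
    next
      case False
      then obtain C where C: "C \<in> ?N" "b \<in> C" using z(3) by auto
      have "z \<notin> C" using C z(2) by auto
      then have "z \<in> nbr ?E C" using C(2) z(4) by (auto simp: nbr_def)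
      then show False using cD(3)[of C] C(1) zT by auto
    qed
  qed
  have cT: "card ?S + 1 = card T" using card.remove[OF fT w] by (simp only: Suc_eq_plus1)
  have fS: "finite (odd_comps ?E (V - ?S))" using finite_V by (intro finite_odd_comps) simp
  have cN: "card (?D - ?N) = card ?D - card ?N" using fD by (intro card_Diff_subset) auto
  have "card ?N \<le> card ?D" using fD by (intro card_mono) auto
  have "card T \<le> card (odd_comps ?E (V - ?S)) + 2"
  proof (cases "card ?N = 1")
    case True
    have "card (?D - ?N) \<le> card (odd_comps ?E (V - ?S))"
      using keep fS by (intro card_mono) auto
    then show ?thesis using cN True st(1) by linarith
  next
    case False
    then have N02: "card ?N = 0 \<or> card ?N = 2" using n by linarith
    have fN: "finite ?N" using fD by auto
    have "connected_in ?E ?B \<and> odd (card ?B)"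
      using N02
    proof
      assume "card ?N = 0"
      then have "?N = {}" using fN by (simp only: card_0_eq)
      then show ?thesis unfolding \<open>?N = {}\<close> by (simp add: connected_in_def)
    next
      assume "card ?N = 2"
      then obtain C D where CD: "?N = {C, D}" "C \<noteq> D" by (meson card_2_iff)
      then have CDN: "C \<in> ?N" "D \<in> ?N" by blast+
      then have mem: "C \<in> ?D" "D \<in> ?D" "w \<in> nbr ?E C" "w \<in> nbr ?E D" using nE by auto
      obtain d where d: "d \<in> D" "{w, d} \<in> ?E" using mem(4) by (auto simp: nbr_def insert_commute)
      have "connected_in ?E (insert w C \<union> D)"
        using connected_in_Un[OF connected_in_insert[OF cD(2)[OF mem(1)] mem(3)] cD(2)[OF mem(2)] _ d] by simp
      moreover have B: "?B = insert w (C \<union> D)" unfolding CD(1) by simp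
      moreover have "card (insert w (C \<union> D)) = Suc (card C + card D)"
      proof -
        have "w \<notin> C \<union> D" using cD(1)[OF mem(1)] cD(1)[OF mem(2)] w by auto
        then show ?thesis
          using cD(4)[OF mem(1)] cD(4)[OF mem(2)] dis[OF mem(1,2) CD(2)]
          by (simp add: card_Un_disjoint)
      qed
      ultimately show ?thesis using st(2)[OF mem(1)] st(2)[OF mem(2)] by simp
    qed
    moreover have "?B \<subseteq> V - ?S" using cD(1) wV by auto
    ultimately have B: "?B \<in> odd_comps ?E (V - ?S)" using NB by (simp add: odd_comps_def comps_def)
    have "?B \<notin> ?D" using cD(1)[of ?B] w by auto
    then have "card (insert ?B (?D - ?N)) = Suc (card (?D - ?N))" using fD by simp
    moreover have "card (insert ?B (?D - ?N)) \<le> card (odd_comps ?E (V - ?S))"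
      using keep fS B by (intro card_mono) auto
    ultimately show ?thesis using cN st(1) N02 by linarith
  qed
  then have "barrier {u, v} ?S" using TV t cT by (auto simp: barrier_def)
  then show False using min[of ?S] cT by simp
qed

end

section \<open>Fragments in a counterexample\<close>

locale high_degree_minimal = planar_critical +
  assumes minimal: "\<And>e. e \<in> E \<Longrightarrow> \<not> factor_critical 3 V (E - {e})"
    and five: "\<And>v. v \<in> V \<Longrightarrow> 5 \<le> card (nbr E {v})"
begin

text \<open>The odd sets for which \<open>odd_nbr\<close> is tight. By
  \<open>barrier_structure\<close> every component left by a barrier is one.\<close>

definition fragment :: "'a set \<Rightarrow> bool" where
  "fragment C \<longleftrightarrow> C \<subseteq> V \<and> odd (card C) \<and> card (nbr E C) = 4"

lemma obtain_minimal_barrier: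
  assumes "e \<in> E"
  obtains T where "barrier e T" "\<And>S. barrier e S \<Longrightarrow> card T \<le> card S"
proof -
  have "minimal_factor_critical 3 V E"
    using critical minimal by (simp add: minimal_factor_critical_def)
  then obtain T where "barrier e T"
    using barrier_exists[OF graph _ assms] unfolding barrier_def by metis
  then show ?thesis using that ex_has_least_nat[of "barrier e" T card] by blast
qed

lemma obtain_minimal_fragment:
  obtains C where "fragment C" "\<And>D. fragment D \<Longrightarrow> card C \<le> card D"
proof -
  obtain v where v: "v \<in> V" using large by fastforce
  have "nbr E {v} \<noteq> {}" using five[OF v] by fastforce
  then obtain w where e: "{v, w} \<in> E" by (auto simp: nbr_def)
  obtain T where T: "barrier {v, w} T" using obtain_minimal_barrier[OF e] by blast
  obtain D where D: "D \<in> comps (E - {{v, w}}) (V - T)" using barrier_structure(4)[OF e T] by blast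
  then have "fragment D"
    using barrier_structure(2,3)[OF e T D] by (auto simp: fragment_def comps_def)
  then show ?thesis using that ex_has_least_nat[of fragment D card] by blast
qed

end

section \<open>A barrier for an edge inside a minimal fragment\<close>

text \<open>Everything up to \<open>no_Dx_contact\<close> holds for an arbitrary edge inside
  \<open>C\<close>; the special choice of the edge enters only in
  \<open>contradiction\<close>.\<close>

locale crossing = high_degree_minimal +
  fixes C :: "'a set" and x y :: 'a and T :: "'a set"
  assumes frag: "fragment C" and C_min: "\<And>D. fragment D \<Longrightarrow> card C \<le> card D"
    and xy: "{x, y} \<in> E" "x \<in> C" "y \<in> C"
    and T: "barrier {x, y} T" and T_min: "\<And>S. barrier {x, y} S \<Longrightarrow> card T \<le> card S"
begin

abbreviation "E' \<equiv> E - {{x, y}}"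
abbreviation "\<D> \<equiv> comps E' (V - T)"
abbreviation "A \<equiv> nbr E C"
abbreviation "R \<equiv> V - C - A"

lemmas barrier_facts = barrier_structure[OF xy(1) T]

lemma T_sub: "T \<subseteq> V" "3 \<le> card T" "finite T"
  using T finite_subset[OF _ finite_V] by (auto simp: barrier_def)

lemma C_facts: "C \<subseteq> V" "odd (card C)" "card A = 4" "finite C"
  using frag finite_subset[OF _ finite_V] by (auto simp: fragment_def)

lemma A_sub: "A \<subseteq> V - C" "finite A"
  using nbr_subset finite_nbr by auto

lemma D_facts:
  assumes "D \<in> \<D>"
  shows "D \<subseteq> V" "D \<inter> T = {}" "finite D" "connected_in E' D" "nbr E' D \<inter> (V - T) = {}" "odd (card D)"
    "card (nbr E D) = 4" "card C \<le> card D"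
proof -
  show 1: "D \<subseteq> V" "D \<inter> T = {}" "connected_in E' D" "nbr E' D \<inter> (V - T) = {}"
    using assms by (auto simp: comps_def)
  show "finite D" using finite_subset[OF 1(1) finite_V] .
  show "odd (card D)" "card (nbr E D) = 4" using barrier_facts(2,3)[OF assms] by auto
  then show "card C \<le> card D" using 1 by (intro C_min) (simp add: fragment_def)
qed

lemma finite_D: "finite \<D>"
  using finite_V by (intro comps_finite) simp

lemma D_disjoint: "B \<in> \<D> \<Longrightarrow> D \<in> \<D> \<Longrightarrow> B \<noteq> D \<Longrightarrow> B \<inter> D = {}"
  by (rule comps_disjoint)



lemma D_step:
  assumes "D \<in> \<D>" "d \<in> D" "{d, w} \<in> E" "{d, w} \<noteq> {x, y}" "w \<notin> T"
  shows "w \<in> D"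
proof (rule ccontr)
  assume "w \<notin> D"
  then have "w \<in> nbr E' D" using assms by (auto simp: nbr_def)
  then show False using D_facts(5)[OF assms(1)] edgeD[OF assms(3)] assms(5) by blast
qed

lemma C_step: "c \<in> C \<Longrightarrow> {c, w} \<in> E \<Longrightarrow> w \<in> C \<union> A"
  by (auto simp: nbr_def)

lemma ends_separated:
  assumes "D \<in> \<D>" "x \<in> D" "y \<in> D" shows False
proof -
  obtain B B' where "B \<in> \<D>" "B' \<in> \<D>" "x \<in> B" "y \<in> B'" "B \<noteq> B'" using barrier_facts(4) by blast
  then show False using D_disjoint[of B D] D_disjoint[of B' D] assms by auto
qed

lemma odd_proper_subset:
  assumes "Y \<subseteq> C" "odd (card Y)" "Y \<noteq> C"
  shows "5 \<le> card (nbr E Y)"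
proof -
  have YV: "Y \<subseteq> V" using assms C_facts by auto
  have "card A \<le> card (V - Y)" using A_sub assms(1) finite_V by (intro card_mono) auto
  then have "4 \<le> card (nbr E Y)" using odd_nbr[OF YV assms(2)] C_facts by simp
  moreover have "card (nbr E Y) \<noteq> 4"
  proof
    assume "card (nbr E Y) = 4"
    then have "card C \<le> card Y" using YV assms by (intro C_min) (simp add: fragment_def)
    moreover have "card Y < card C" using assms C_facts by (intro psubset_card_mono) auto
    ultimately show False by simp
  qed
  ultimately show ?thesis by simp
qed

text \<open>Otherwise submodularity makes \<open>D \<inter> C\<close> a fragment, so \<open>C \<subseteq> D\<close>; but the edge \<open>{x, y}\<close> inside \<open>C\<close>
  joins different components.\<close>

lemma even_part:
  assumes D: "D \<in> \<D>"
  shows "even (card (D \<inter> C))"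
proof (rule ccontr)
  assume odd: "odd (card (D \<inter> C))"
  have "D \<inter> C \<noteq> C"
  proof
    assume "D \<inter> C = C"
    then have "x \<in> D" "y \<in> D" using xy by auto
    then show False using ends_separated D by blast
  qed
  then have 1: "5 \<le> card (nbr E (D \<inter> C))" using odd by (intro odd_proper_subset) auto
  have "card D + card C = card (D \<union> C) + card (D \<inter> C)"
    using card_Un_Int D_facts(3)[OF D] C_facts(4) by blast
  then have odd': "odd (card (D \<union> C))"
    using odd D_facts(6)[OF D] C_facts(2) by presburger
  obtain B where B: "B \<in> \<D>" "B \<noteq> D"
    using barrier_facts(4) by metis
  \<comment> \<open>Room for \<open>odd_nbr\<close>: B is a fragment and so at least as large as C.
    Hence at least |T| vertices of T and B together lie outside C, and none of them is in D.\<close>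
  have "T \<union> B - C \<subseteq> V - (D \<union> C)"
    using D_disjoint[OF B(1) D B(2)] D_facts(1)[OF B(1)] D_facts(2)[OF D] T_sub(1) by auto
  then have "card (T \<union> B - C) \<le> card (V - (D \<union> C))" using finite_V by (intro card_mono) auto
  moreover have "card (T \<union> B) = card T + card B"
    using D_facts(2,3)[OF B(1)] T_sub(3) by (intro card_Un_disjoint) auto
  moreover have "card (T \<union> B) \<le> card (T \<union> B - C) + card C"
    using diff_card_le_card_Diff[OF C_facts(4), of "T \<union> B"] by linarith
  ultimately have "3 \<le> card (V - (D \<union> C))" using D_facts(8)[OF B(1)] T_sub(2) by linarith
  then have "4 \<le> card (nbr E (D \<union> C))"
    using odd' D_facts(1)[OF D] C_facts(1) by (intro odd_nbr) auto
  then show False using 1 nbr_submodular[of D C] D_facts(7)[OF D] C_facts(3) by linarith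
qed

section \<open>How C and A are distributed over T and the components\<close>

lemma Diff_T_parts:
  assumes "W \<subseteq> V"
  shows "W - T = (\<Union>D\<in>\<D>. D \<inter> W)"
proof -
  have "W - T = (V - T) \<inter> W" using assms by auto
  also have "\<dots> = (\<Union>\<D>) \<inter> W" unfolding Union_comps ..
  finally show ?thesis by blast
qed

lemma card_parts_sum:
  assumes "W \<subseteq> V"
  shows "card (W - T) = (\<Sum>D\<in>\<D>. card (D \<inter> W))"
  unfolding Diff_T_parts[OF assms]
proof (rule card_UN_disjoint[OF finite_D])
  show "\<forall>D\<in>\<D>. finite (D \<inter> W)"
    using finite_subset[OF assms finite_V] by simp
  show "\<forall>B\<in>\<D>. \<forall>D\<in>\<D>. B \<noteq> D \<longrightarrow> (B \<inter> W) \<inter> (D \<inter> W) = {}"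
  proof (intro ballI impI)
    fix B D assume "B \<in> \<D>" "D \<in> \<D>" "B \<noteq> D"
    from D_disjoint[OF this] show "(B \<inter> W) \<inter> (D \<inter> W) = {}" by auto
  qed
qed

lemma odd_TC: "odd (card (T \<inter> C))"
proof -
  note card_parts_sum[OF C_facts(1)]
  moreover have "even (\<Sum>D\<in>\<D>. card (D \<inter> C))" using even_part by (intro dvd_sum) auto
  moreover have "card C = card (C - T) + card (T \<inter> C)"
    using card_Int_Diff[OF C_facts(4), of T] by (simp add: Int_commute)
  ultimately show ?thesis using C_facts(2) by simp
qed

lemma card_A_parts: "(\<Sum>D\<in>\<D>. card (D \<inter> A)) + card (T \<inter> A) = 4"
proof -
  have "A \<subseteq> V" using A_sub by auto
  note card_parts_sum[OF this]
  moreover have "card A = card (A - T) + card (T \<inter> A)"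
    using card_Int_Diff[OF A_sub(2), of T] by (simp add: Int_commute)
  ultimately show ?thesis using C_facts(3) by simp
qed

text \<open>A connected \<open>D\<close> that starts in \<open>C\<close> and avoids \<open>A\<close>
  stays in \<open>C\<close>. Then D \<inter> C = D would be odd, contrary to
  \<open>even_part\<close>.\<close>

lemma meets_A:
  assumes D: "D \<in> \<D>" "D \<inter> C \<noteq> {}"
  shows "D \<inter> A \<noteq> {}"
proof
  assume no: "D \<inter> A = {}"
  obtain c where c: "c \<in> D" "c \<in> C" using D by auto
  have "D \<subseteq> C"
  proof (rule connected_in_closed[OF D_facts(4)[OF D(1)] c])
    fix a b assume "{a, b} \<in> E'" "b \<in> D" "a \<in> C"
    then show "b \<in> C" using C_step[of a b] no by auto
  qed
  then have "D \<inter> C = D" by auto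
  then show False using even_part[OF D(1)] D_facts(6)[OF D(1)] by simp
qed

lemma part_nbr:
  assumes D: "D \<in> \<D>" and z: "z \<in> D" "z \<in> {x, y}" and Y: "Y \<in> comps E (D \<inter> C - {z})"
  shows "nbr E Y \<subseteq> insert z ((D \<inter> A) \<union> (T \<inter> C) \<union> (T \<inter> A))"
proof
  fix w assume "w \<in> nbr E Y"
  then obtain d where d: "d \<in> Y" "{d, w} \<in> E" "w \<notin> Y" by (auto simp: nbr_def)
  have YD: "Y \<subseteq> D \<inter> C - {z}" "nbr E Y \<inter> (D \<inter> C - {z}) = {}" using Y by (auto simp: comps_def)
  have "w \<notin> D \<inter> C - {z}" using YD(2) \<open>w \<in> nbr E Y\<close> by auto
  moreover have "w \<in> C \<union> A" using C_step d YD by blast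
  moreover have "w \<in> D \<union> T"
  proof -
    have "d \<notin> {x, y}"
      using YD(1) d(1) z ends_separated[OF D] by auto
    then have "{d, w} \<noteq> {x, y}" by auto
    then show ?thesis using D_step[OF D, of d w] d YD(1) by blast
  qed
  ultimately show "w \<in> insert z ((D \<inter> A) \<union> (T \<inter> C) \<union> (T \<inter> A))" by blast
qed

text \<open>Removing z from the even set D \<inter> C makes it odd, so it has an odd component. This
  is a proper subset of the minimal fragment, hence has five neighbours rather than four.\<close>

lemma odd_part:
  assumes D: "D \<in> \<D>" and z: "z \<in> D" "z \<in> {x, y}"
  obtains Y where "Y \<in> comps E (D \<inter> C - {z})" "5 \<le> card (nbr E Y)"
proof -
  have zC: "z \<in> D \<inter> C" using z xy by auto
  have fin: "finite (D \<inter> C)" using D_facts(3)[OF D] by simp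
  have "odd (card (D \<inter> C - {z}))"
    using even_part[OF D] card.remove[OF fin zC] by simp
  then obtain Y where Y: "Y \<in> odd_comps E (D \<inter> C - {z})"
    using odd_comp_exists fin by blast
  then have "Y \<in> comps E (D \<inter> C - {z})" "odd (card Y)" by (auto simp: odd_comps_def)
  moreover from this have "Y \<subseteq> D \<inter> C - {z}" by (simp add: comps_def)
  then have "Y \<subseteq> C" "Y \<noteq> C" using zC by auto
  ultimately show ?thesis using that odd_proper_subset by blast
qed

lemma card_parts:
  "card (insert z ((D \<inter> A) \<union> (T \<inter> C) \<union> (T \<inter> A))) \<le> card (D \<inter> A) + card (T \<inter> C) + card (T \<inter> A) + 1"
proof -
  have "card (insert z ((D \<inter> A) \<union> (T \<inter> C) \<union> (T \<inter> A))) \<le> Suc (card ((D \<inter> A) \<union> (T \<inter> C) \<union> (T \<inter> A)))"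
    by (rule card_insert_le_m1[THEN order_trans]) auto
  moreover have "card ((D \<inter> A) \<union> (T \<inter> C) \<union> (T \<inter> A)) \<le> card ((D \<inter> A) \<union> (T \<inter> C)) + card (T \<inter> A)"
    "card ((D \<inter> A) \<union> (T \<inter> C)) \<le> card (D \<inter> A) + card (T \<inter> C)"
    by (rule card_Un_le)+
  ultimately show ?thesis by linarith
qed

lemma finite_parts: "finite (insert z ((D \<inter> A) \<union> (T \<inter> C) \<union> (T \<inter> A)))"
  using A_sub T_sub by simp

text \<open>Of the five neighbours of an odd part, z accounts for at most one.\<close>

lemma part_bound:
  assumes D: "D \<in> \<D>" and z: "z \<in> D" "z \<in> {x, y}"
  shows "4 \<le> card (T \<inter> C) + card (T \<inter> A) + card (D \<inter> A)"
proof -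
  obtain Y where Y: "Y \<in> comps E (D \<inter> C - {z})" "5 \<le> card (nbr E Y)" using odd_part[OF assms] .
  have "card (nbr E Y) \<le> card (insert z ((D \<inter> A) \<union> (T \<inter> C) \<union> (T \<inter> A)))"
    by (rule card_mono[OF finite_parts part_nbr[OF D z Y(1)]])
  then show ?thesis using Y(2) card_parts[of z D] by linarith
qed

lemma part_tight:
  assumes D: "D \<in> \<D>" and z: "z \<in> D" "z \<in> {x, y}"
    and le: "card (T \<inter> C) + card (T \<inter> A) + card (D \<inter> A) \<le> 4"
    and Y: "Y \<in> comps E (D \<inter> C - {z})" "5 \<le> card (nbr E Y)"
  shows "nbr E Y = insert z ((D \<inter> A) \<union> (T \<inter> C) \<union> (T \<inter> A))"
  by (rule card_seteq[OF finite_parts part_nbr[OF D z Y(1)]])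
     (use Y(2) card_parts[of z D] le in linarith)

definition Dx where "Dx = (SOME D. D \<in> \<D> \<and> x \<in> D)"
definition Dy where "Dy = (SOME D. D \<in> \<D> \<and> y \<in> D)"

lemma Dxy: "Dx \<in> \<D>" "Dy \<in> \<D>" "x \<in> Dx" "y \<in> Dy" "Dx \<noteq> Dy" "Dx \<inter> Dy = {}"
    "card (nbr E Dx \<inter> T) = 3" "card (nbr E Dy \<inter> T) = 3"
proof -
  obtain B D where BD: "B \<in> \<D>" "D \<in> \<D>" "x \<in> B" "y \<in> D" "B \<noteq> D"
      "card (nbr E B \<inter> T) = 3" "card (nbr E D \<inter> T) = 3" using barrier_facts(4) by blast
  have "Dx = B" unfolding Dx_def
    by (rule some_equality) (use BD D_disjoint in blast)+
  moreover have "Dy = D" unfolding Dy_def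
    by (rule some_equality) (use BD D_disjoint in blast)+
  ultimately show "Dx \<in> \<D>" "Dy \<in> \<D>" "x \<in> Dx" "y \<in> Dy" "Dx \<noteq> Dy" "Dx \<inter> Dy = {}"
    "card (nbr E Dx \<inter> T) = 3" "card (nbr E Dy \<inter> T) = 3"
    using BD D_disjoint by blast+
qed

lemma A_part_pos: "1 \<le> card (Dx \<inter> A)" "1 \<le> card (Dy \<inter> A)"
proof -
  have "Dx \<inter> A \<noteq> {}" "Dy \<inter> A \<noteq> {}" using meets_A Dxy xy by blast+
  then show "1 \<le> card (Dx \<inter> A)" "1 \<le> card (Dy \<inter> A)"
    using A_sub(2) by (simp_all add: Suc_le_eq card_gt_0_iff)
qed

text \<open>If \<open>|T| \<ge> 4\<close>, minimality of \<open>T\<close> makes each vertex of \<open>T \<inter> C\<close> touch three components, and counting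
  forces \<open>T \<inter> C\<close> itself to be a barrier.\<close>

lemma card_T_eq_3: "card T = 3"
proof (rule ccontr)
  assume "card T \<noteq> 3"
  then have t: "4 \<le> card T" using T_sub by simp
  \<comment> \<open>Only components meeting A matter: by \<open>meets_A\<close> every component
    touched by a vertex of T \<inter> C is among them.\<close>
  let ?K = "{D \<in> \<D>. D \<inter> A \<noteq> {}}"
  have fK: "finite ?K" using finite_D by simp
  have fTC: "finite (T \<inter> C)" using T_sub by simp
  have nbrK: "{D \<in> \<D>. w \<in> nbr E D} \<subseteq> {D \<in> ?K. w \<in> nbr E D}" if w: "w \<in> T \<inter> C" for w
  proof
    fix D assume D: "D \<in> {D \<in> \<D>. w \<in> nbr E D}"
    then obtain d where d: "d \<in> D" "{w, d} \<in> E" by (auto simp: nbr_def insert_commute)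
    have "d \<in> C \<union> A" using C_step w d(2) by blast
    then have "D \<inter> A \<noteq> {}" using meets_A[of D] D d(1) by blast
    then show "D \<in> {D \<in> ?K. w \<in> nbr E D}" using D by auto
  qed
  have three: "3 \<le> card {D \<in> ?K. w \<in> nbr E D}" if w: "w \<in> T \<inter> C" for w
  proof -
    have "3 \<le> card {D \<in> \<D>. w \<in> nbr E D}"
      using minimal_barrier_degree[OF xy(1) T T_min t] w by auto
    also have "\<dots> \<le> card {D \<in> ?K. w \<in> nbr E D}" using finite_D by (intro card_mono[OF _ nbrK[OF w]]) simp
    finally show ?thesis .
  qed
  obtain w where w: "w \<in> T \<inter> C" using odd_TC by (metis card.empty even_zero ex_in_conv)
  have "card {D \<in> ?K. w \<in> nbr E D} \<le> card ?K" using fK by (intro card_mono) auto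
  then have k3: "3 \<le> card ?K" using three[OF w] by linarith
  have "(\<Sum>D\<in>?K. card (nbr E D \<inter> (T \<inter> C))) + 4 \<le> 2 * card (T \<inter> C) + 2 * card ?K"
    unfolding distrib_left[symmetric]
  proof (rule planar_contact_bound[OF graph planar])
    show "T \<inter> C \<subseteq> V" using T_sub by auto
    show "D \<subseteq> V - T \<inter> C" "connected_in E D" if "D \<in> ?K" for D
      using D_facts(1,2,4)[of D] that by (auto intro: connected_in_mono)
    show "B \<inter> D = {}" if "B \<in> ?K" "D \<in> ?K" "B \<noteq> D" for B D using D_disjoint that by blast
    show "3 \<le> card (T \<inter> C) + card ?K" using k3 by simp
  qed
  moreover have "(\<Sum>D\<in>?K. card (nbr E D \<inter> (T \<inter> C))) = (\<Sum>w\<in>T \<inter> C. card {D \<in> ?K. w \<in> nbr E D})"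
  proof -
    have "(\<Sum>D\<in>?K. card (nbr E D \<inter> (T \<inter> C))) = (\<Sum>D\<in>?K. card {w \<in> T \<inter> C. w \<in> nbr E D})"
      by (intro sum.cong refl arg_cong[where f=card]) auto
    then show ?thesis using sum_card_swap[OF fK fTC, of "\<lambda>D w. w \<in> nbr E D"] by simp
  qed
  moreover have "3 * card (T \<inter> C) \<le> (\<Sum>w\<in>T \<inter> C. card {D \<in> ?K. w \<in> nbr E D})"
    using sum_bounded_below[of "T \<inter> C" 3 "\<lambda>w. card {D \<in> ?K. w \<in> nbr E D}"] three by (simp add: mult.commute)
  \<comment> \<open>Three contacts per vertex of T \<inter> C against the planar bound 2|T \<inter>
    C| + 2|K| - 4.\<close>
  ultimately have k: "card (T \<inter> C) + 4 \<le> 2 * card ?K" by linarith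
  have "(\<Sum>D\<in>\<D>. card (D \<inter> A)) = (\<Sum>D\<in>?K. card (D \<inter> A))"
    using finite_D by (intro sum.mono_neutral_right) auto
  also have "\<dots> = card (Dx \<inter> A) + (card (Dy \<inter> A) + (\<Sum>D\<in>?K - {Dx} - {Dy}. card (D \<inter> A)))"
  proof -
    have m: "Dx \<in> ?K" "Dy \<in> ?K - {Dx}" using Dxy A_part_pos by auto
    show ?thesis
      by (subst sum.remove[OF fK m(1)], subst sum.remove[OF finite_Diff[OF fK] m(2)], rule refl)
  qed
  finally have sumA: "(\<Sum>D\<in>\<D>. card (D \<inter> A)) =
      card (Dx \<inter> A) + (card (Dy \<inter> A) + (\<Sum>D\<in>?K - {Dx} - {Dy}. card (D \<inter> A)))" .
  moreover have "card (?K - {Dx} - {Dy}) \<le> (\<Sum>D\<in>?K - {Dx} - {Dy}. card (D \<inter> A))"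
  proof -
    have "1 \<le> card (D \<inter> A)" if "D \<in> ?K - {Dx} - {Dy}" for D
      using that A_sub(2) by (auto simp: Suc_le_eq card_gt_0_iff)
    then show ?thesis
      using sum_bounded_below[of "?K - {Dx} - {Dy}" 1 "\<lambda>D. card (D \<inter> A)"] by simp
  qed
  moreover have "card (?K - {Dx} - {Dy}) = card ?K - 2"
  proof -
    have m: "Dx \<in> ?K" "Dy \<in> ?K - {Dx}" using Dxy A_part_pos by auto
    have "card (?K - {Dx} - {Dy}) = card ?K - 1 - 1"
      by (simp only: card_Diff_singleton[OF m(2)] card_Diff_singleton[OF m(1)])
    then show ?thesis by simp
  qed
  \<comment> \<open>The four vertices of A are shared out: each of the |K| - 2 components other than
    Dx and Dy takes at least one.\<close>
  ultimately have A4: "card (Dx \<inter> A) + card (Dy \<inter> A) + card ?K + card (T \<inter> A) \<le> 6"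
    using card_A_parts k3 by linarith
  have px: "4 \<le> card (T \<inter> C) + card (T \<inter> A) + card (Dx \<inter> A)"
    and py: "4 \<le> card (T \<inter> C) + card (T \<inter> A) + card (Dy \<inter> A)"
    using part_bound Dxy by auto
  \<comment> \<open>If |K| = 3, then |T \<inter> C| is odd and at most 2, hence 1, and
    \<open>px\<close> asks for more vertices of A than \<open>A4\<close> allows. So |K| = 4, the
    shares of A are 1, 1, 0, and 3 \<le> |T \<inter> C| \<le> 4 with odd parity leaves 3.\<close>
  have all: "card ?K = 4 \<and> card (Dx \<inter> A) = 1 \<and> card (Dy \<inter> A) = 1 \<and> card (T \<inter> A) = 0 \<and> card (T \<inter> C) = 3"
  proof -
    have "card ?K \<noteq> 3"
    proof
      assume "card ?K = 3"
      moreover from this have "card (T \<inter> C) \<le> 2" using k by linarith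
      then have "card (T \<inter> C) = 1" using odd_TC by presburger
      ultimately show False using A4 px py A_part_pos by linarith
    qed
    then have "card ?K = 4" using A4 A_part_pos k3 by linarith
    moreover from this have "card (Dx \<inter> A) = 1" "card (Dy \<inter> A) = 1" "card (T \<inter> A) = 0"
      using A4 A_part_pos by linarith+
    moreover from this have "3 \<le> card (T \<inter> C)" using px by linarith
    moreover have "card (T \<inter> C) \<noteq> 4" using odd_TC by (metis even_numeral)
    ultimately show ?thesis using k by linarith
  qed
  \<comment> \<open>\<open>part_tight\<close> makes all three vertices of T \<inter> C neighbours of
    D, and D has only three neighbours in T.\<close>
  have sub: "nbr E D \<inter> T = T \<inter> C"
    if D: "D \<in> \<D>" "z \<in> D" "z \<in> {x, y}" "card (D \<inter> A) = 1" "card (nbr E D \<inter> T) = 3" for D z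
  proof -
    obtain Y where Y: "Y \<in> comps E (D \<inter> C - {z})" "5 \<le> card (nbr E Y)" using odd_part[OF D(1-3)] .
    have "T \<inter> C \<subseteq> nbr E Y" using part_tight[OF D(1-3) _ Y] all D(4) by auto
    moreover have "Y \<subseteq> D" using Y by (auto simp: comps_def)
    moreover from this have "nbr E Y \<subseteq> D \<union> nbr E D" unfolding nbr_def by blast
    ultimately have "T \<inter> C \<subseteq> nbr E D \<inter> T" using D_facts(2)[OF D(1)] by blast
    then have "T \<inter> C = nbr E D \<inter> T" using D(5) all T_sub(3) by (intro card_subset_eq) auto
    then show ?thesis by simp
  qed
  have comp: "D \<in> odd_comps E' (V - T \<inter> C)"
    if D: "D \<in> \<D>" and n: "nbr E D \<inter> T = T \<inter> C" for D
  proof -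
    have "nbr E' D \<subseteq> nbr E D" by (auto simp: nbr_def)
    then have "nbr E' D \<inter> (V - T \<inter> C) = {}" using D_facts(5)[OF D] n by auto
    then show ?thesis using D_facts[OF D] by (auto simp: odd_comps_def comps_def)
  qed
  have "{Dx, Dy} \<subseteq> odd_comps E' (V - T \<inter> C)"
    using comp[OF Dxy(1) sub[OF Dxy(1,3)]] comp[OF Dxy(2) sub[OF Dxy(2,4)]] Dxy(7,8) all by simp
  then have "card {Dx, Dy} \<le> card (odd_comps E' (V - T \<inter> C))"
    using finite_V by (intro card_mono finite_odd_comps) auto
  \<comment> \<open>Dx and Dy survive as odd components when only T \<inter> C is deleted, and two
    of them suffice for a barrier of size three.\<close>
  then have "barrier {x, y} (T \<inter> C)" using all Dxy(5) T_sub(1) by (auto simp: barrier_def)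
  then have "card T \<le> card (T \<inter> C)" by (rule T_min)
  then show False using all t by simp
qed

section \<open>Barriers with three vertices\<close>

lemma D_eq: "\<D> = {Dx, Dy}"
proof -
  have "card \<D> = 2" using barrier_facts(1) card_T_eq_3 by simp
  then have "{Dx, Dy} = \<D>" using Dxy finite_D by (intro card_seteq) auto
  then show ?thesis by simp
qed

lemma card_A_xy: "card (Dx \<inter> A) + card (Dy \<inter> A) + card (T \<inter> A) = 4"
  using card_A_parts Dxy(5) unfolding D_eq by simp

lemma card_D_split: "D \<in> \<D> \<Longrightarrow> card D = card (D \<inter> C) + card (D \<inter> A) + card (D \<inter> R)"
proof -
  assume D: "D \<in> \<D>"
  have "D = (D \<inter> C) \<union> ((D \<inter> A) \<union> (D \<inter> R))" using D_facts(1)[OF D] by auto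
  moreover have "card ((D \<inter> C) \<union> ((D \<inter> A) \<union> (D \<inter> R))) = card (D \<inter> C) + card ((D \<inter> A) \<union> (D \<inter> R))"
    using D_facts(3)[OF D] A_sub by (intro card_Un_disjoint) auto
  moreover have "card ((D \<inter> A) \<union> (D \<inter> R)) = card (D \<inter> A) + card (D \<inter> R)"
    using D_facts(3)[OF D] by (intro card_Un_disjoint) auto
  ultimately show ?thesis by simp
qed

text \<open>The extra 1 is the other end of the edge {x, y}, which lies in \<open>C\<close> but
  neither in \<open>D\<close> nor in \<open>T\<close>.\<close>

lemma card_C_ge:
  assumes D: "D \<in> {Dx, Dy}"
  shows "card (T \<inter> C) + card (D \<inter> C) + 1 \<le> card C"
proof -
  obtain z where z: "z \<in> C" "z \<notin> D" "z \<notin> T"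
    using D Dxy xy D_facts(2)[OF Dxy(1)] D_facts(2)[OF Dxy(2)] by (metis disjoint_iff insertE singletonD)
  have DD: "D \<in> \<D>" using D Dxy by auto
  have "card (insert z ((T \<inter> C) \<union> (D \<inter> C))) = Suc (card (T \<inter> C) + card (D \<inter> C))"
    using z C_facts(4) D_facts(2)[OF DD] by (subst card_insert_disjoint) (auto intro!: card_Un_disjoint)
  moreover have "card (insert z ((T \<inter> C) \<union> (D \<inter> C))) \<le> card C"
    using z C_facts(4) by (intro card_mono) auto
  ultimately show ?thesis by simp
qed

lemma R_part_nbr:
  assumes D: "D \<in> {Dx, Dy}" and Y: "Y \<subseteq> D \<inter> R"
  shows "nbr E Y \<subseteq> (T - C) \<union> (D - C)"
proof
  fix w assume "w \<in> nbr E Y"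
  then obtain d where d: "d \<in> Y" "{d, w} \<in> E" by (auto simp: nbr_def)
  have dR: "d \<in> D" "d \<notin> C" "d \<notin> A" using d Y by auto
  have "w \<notin> C"
  proof
    assume "w \<in> C"
    then have "d \<in> C \<union> A" using C_step[of w d] d(2) by (simp add: insert_commute)
    then show False using dR by simp
  qed
  moreover have "{d, w} \<noteq> {x, y}" using dR xy by auto
  then have "w \<in> D \<union> T" using D_step[of D d w] D Dxy dR d by blast
  ultimately show "w \<in> (T - C) \<union> (D - C)" by blast
qed

text \<open>Otherwise T lies in C, and one of the two components, D, has at most two vertices in A.
  These would separate D \<inter> R from the rest, so D \<inter> R is empty by 3-connectivity. Then
  |D| \<le> (|C| - 4) + 2, but D is a fragment and cannot be smaller than C.\<close>

lemma card_TC_eq_1: "card (T \<inter> C) = 1"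
proof (rule ccontr)
  assume n: "card (T \<inter> C) \<noteq> 1"
  have "card (T \<inter> C) \<le> 3" using card_mono[of T "T \<inter> C"] T_sub card_T_eq_3 by simp
  then have 3: "card (T \<inter> C) = 3" using n odd_TC by presburger
  then have "T \<inter> C = T" using T_sub card_T_eq_3 by (intro card_subset_eq) auto
  then have TC: "T \<subseteq> C" by auto
  then have TA: "T \<inter> A = {}" using A_sub by auto
  obtain D where D: "D \<in> {Dx, Dy}" "card (D \<inter> A) \<le> 2"
  proof (cases "card (Dx \<inter> A) \<le> 2")
    case False
    then have "card (Dy \<inter> A) \<le> 2" using card_A_xy by linarith
    then show ?thesis using that by blast
  qed (use that in blast)
  then have DD: "D \<in> \<D>" using Dxy by auto
  have "D \<inter> R = {}"
  proof (rule ccontr)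
    assume ne: "D \<inter> R \<noteq> {}"
    have sub: "nbr E (D \<inter> R) \<subseteq> D \<inter> A"
    proof
      fix w assume w: "w \<in> nbr E (D \<inter> R)"
      have "w \<in> D - C" using R_part_nbr[OF D(1) order_refl] TC w by auto
      moreover have "w \<notin> D \<inter> R" using w by (auto simp: nbr_def)
      ultimately show "w \<in> D \<inter> A" using D_facts(1)[OF DD] by auto
    qed
    have "x \<in> V - (D \<inter> R) - nbr E (D \<inter> R)" using xy C_facts(1) sub A_sub by auto
    then have "3 \<le> card (nbr E (D \<inter> R))" using ne by (intro three_connected) auto
    also have "\<dots> \<le> card (D \<inter> A)" using sub A_sub by (intro card_mono) auto
    finally show False using D(2) by simp
  qed
  then have "card D = card (D \<inter> C) + card (D \<inter> A)" using card_D_split[OF DD] by simp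
  then show False using card_C_ge[OF D(1)] D_facts(8)[OF DD] 3 D(2) by linarith
qed

text \<open>Adding both instances of \<open>part_bound\<close> and subtracting
  \<open>card_A_xy\<close> gives |T \<inter> A| \<ge> 2, while T has only two vertices outside
  C.\<close>

lemma tight: "card (T \<inter> A) = 2" "card (Dx \<inter> A) = 1" "card (Dy \<inter> A) = 1"
proof -
  have "card (T \<inter> A) + card (T \<inter> C) \<le> card T"
  proof -
    have "card (T \<inter> A) + card (T \<inter> C) = card ((T \<inter> A) \<union> (T \<inter> C))"
      using T_sub(3) A_sub by (intro card_Un_disjoint[symmetric]) auto
    also have "\<dots> \<le> card T" using T_sub(3) by (intro card_mono) auto
    finally show ?thesis .
  qed
  moreover have "4 \<le> card (T \<inter> C) + card (T \<inter> A) + card (Dx \<inter> A)"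
    "4 \<le> card (T \<inter> C) + card (T \<inter> A) + card (Dy \<inter> A)"
    using part_bound Dxy by auto
  ultimately show "card (T \<inter> A) = 2" "card (Dx \<inter> A) = 1" "card (Dy \<inter> A) = 1"
    using card_A_xy card_T_eq_3 card_TC_eq_1 A_part_pos by presburger+
qed

lemma T_eq: "T = (T \<inter> C) \<union> (T \<inter> A)"
proof -
  have "card ((T \<inter> C) \<union> (T \<inter> A)) = card (T \<inter> C) + card (T \<inter> A)"
    using T_sub(3) A_sub by (intro card_Un_disjoint) auto
  then have "card ((T \<inter> C) \<union> (T \<inter> A)) = card T" using tight card_TC_eq_1 card_T_eq_3 by simp
  then have "(T \<inter> C) \<union> (T \<inter> A) = T" using T_sub(3) by (intro card_subset_eq) auto
  then show ?thesis by simp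
qed

text \<open>By \<open>T_eq\<close> only the three vertices of T \<inter> A and D \<inter> A can be
  neighbours of \<open>Y\<close>, and 3-connectivity demands all three, with x as a vertex
  beyond.\<close>

lemma R_component_nbr:
  assumes D: "D \<in> {Dx, Dy}" and Y: "connected_in E Y" "Y \<subseteq> D \<inter> R" "nbr E Y \<inter> (D \<inter> R) = {}"
  shows "nbr E Y = (T \<inter> A) \<union> (D \<inter> A)" "card (nbr E Y) = 3"
proof -
  have DV: "D \<subseteq> V" using D Dxy D_facts(1) by blast
  have sub: "nbr E Y \<subseteq> (T \<inter> A) \<union> (D \<inter> A)"
  proof
    fix w assume w: "w \<in> nbr E Y"
    then have "w \<in> (T - C) \<union> (D - C)" using R_part_nbr[OF D Y(2)] by blast
    then show "w \<in> (T \<inter> A) \<union> (D \<inter> A)" using T_eq Y(3) w DV by blast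
  qed
  have le: "card ((T \<inter> A) \<union> (D \<inter> A)) \<le> 3"
    using card_Un_le[of "T \<inter> A" "D \<inter> A"] tight D by auto
  have "x \<in> V - Y - nbr E Y" using xy C_facts(1) Y(2) sub A_sub by auto
  then have ge: "3 \<le> card (nbr E Y)" using Y by (intro three_connected) (auto simp: connected_in_def)
  have fin: "finite ((T \<inter> A) \<union> (D \<inter> A))" using A_sub by simp
  show "nbr E Y = (T \<inter> A) \<union> (D \<inter> A)"
    using fin sub by (rule card_seteq) (use le ge in linarith)
  then show "card (nbr E Y) = 3" using le ge by simp
qed

lemma R_component:
  assumes D: "D \<in> {Dx, Dy}"
  obtains Y where "connected_in E Y" "Y \<subseteq> D \<inter> R" "nbr E Y = (T \<inter> A) \<union> (D \<inter> A)"
proof -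
  have DD: "D \<in> \<D>" using D Dxy by auto
  have "card (D \<inter> A) = 1" using D tight by auto
  \<comment> \<open>D is at least as large as C, and C contains at least two vertices outside D, but
    D has only one vertex in A to make up for them.\<close>
  then have "card (D \<inter> R) \<noteq> 0"
    using card_D_split[OF DD] card_C_ge[OF D] D_facts(8)[OF DD] card_TC_eq_1 by linarith
  then obtain r where "r \<in> D \<inter> R" by (metis card.empty ex_in_conv)
  then obtain Y where "Y \<in> comps E (D \<inter> R)" using Union_comps[of E "D \<inter> R"] by blast
  then have Y: "connected_in E Y" "Y \<subseteq> D \<inter> R" "nbr E Y \<inter> (D \<inter> R) = {}" by (auto simp: comps_def)
  then show ?thesis using that R_component_nbr(1)[OF D Y] by blast
qed

lemma A_eq: "A = (T \<inter> A) \<union> (Dx \<inter> A) \<union> (Dy \<inter> A)"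
proof -
  have "A \<subseteq> V" using A_sub by auto
  from Diff_T_parts[OF this] have "A - T = (Dx \<inter> A) \<union> (Dy \<inter> A)" by (simp add: D_eq)
  then show ?thesis by blast
qed

text \<open>The three sets of the K(3,3) minor are a part \<open>Y\<close> of the rest, an odd part \<open>P\<close> of \<open>Dx \<inter> C - {x}\<close>, and
  \<open>Dy\<close> extended by \<open>x\<close>.\<close>

lemma no_Dx_contact:
  assumes "a \<in> Dx \<inter> A" "{x, a} \<in> E"
  shows False
proof -
  let ?T = "(T \<inter> A) \<union> (Dx \<inter> A)"
  obtain Y where Y: "connected_in E Y" "Y \<subseteq> Dx \<inter> R" "nbr E Y = ?T" using R_component[of Dx] by auto
  obtain P where P: "P \<in> comps E (Dx \<inter> C - {x})" "5 \<le> card (nbr E P)"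
    using odd_part[OF Dxy(1,3)] by blast
  have PC: "P \<subseteq> Dx \<inter> C - {x}" "connected_in E P" using P by (auto simp: comps_def)
  have "nbr E P = insert x ((Dx \<inter> A) \<union> (T \<inter> C) \<union> (T \<inter> A))"
    using part_tight[OF Dxy(1,3) _ _ P] tight card_TC_eq_1 by simp
  then have nP: "nbr E P \<inter> ?T = ?T" by auto
  let ?Z = "insert x Dy"
  have xDy: "x \<notin> Dy" using Dxy by auto
  have "x \<in> nbr E Dy" using xy(1) Dxy(4) xDy by (auto simp: nbr_def insert_commute)
  moreover have "connected_in E Dy" using D_facts(4)[OF Dxy(2)] by (rule connected_in_mono) auto
  ultimately have Z: "connected_in E ?Z" by (rule connected_in_insert[rotated])
  have a1: "Dx \<inter> A = {a}" using tight(2) assms(1) by (metis card_1_singletonE singletonD)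
  have "nbr E Dy \<inter> T = T" using Dxy(8) card_T_eq_3 T_sub(3) by (intro card_subset_eq) auto
  then have "T \<inter> A \<subseteq> nbr E Dy" by auto
  moreover have xA: "x \<notin> A" using xy A_sub by auto
  ultimately have TZ: "T \<inter> A \<subseteq> nbr E ?Z" by (auto simp: nbr_def)
  have aDy: "a \<notin> Dy" "a \<noteq> x" using assms(1) Dxy(6) xA by auto
  \<comment> \<open>The assumed edge from x to a is used here: Dy supplies the contacts with T
    \<inter> A, and x the one with a.\<close>
  then have "a \<in> nbr E ?Z" using assms(2) by (auto simp: nbr_def)
  then have nZ: "nbr E ?Z \<inter> ?T = ?T" using TZ a1 by auto
  have nY: "nbr E Y \<inter> ?T = ?T" using Y(3) by auto
  have cT: "card ?T = 3"
  proof -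
    have "card ?T = card (T \<inter> A) + card (Dx \<inter> A)"
      using A_sub D_facts(2)[OF Dxy(1)] by (intro card_Un_disjoint) auto
    then show ?thesis using tight by simp
  qed
  have d1: "P \<inter> Y = {}" "P \<inter> ?Z = {}" "Y \<inter> ?Z = {}"
    using PC(1) Y(2) Dxy(6) xy(2) by auto
  have ne: "P \<noteq> {}" "Y \<noteq> {}" using PC Y by (auto simp: connected_in_def)
  then have dist: "P \<noteq> Y" "P \<noteq> ?Z" "Y \<noteq> ?Z" using d1 by auto
  \<comment> \<open>Three sets with three contacts each: 9 + 4 exceeds 2 * 6.\<close>
  have "(\<Sum>D\<in>{P, Y, ?Z}. card (nbr E D \<inter> ?T)) + 4 \<le> 2 * (card ?T + card {P, Y, ?Z})"
  proof (rule planar_contact_bound[OF graph planar])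
    show "?T \<subseteq> V" using A_sub by auto
    show "D \<subseteq> V - ?T" if "D \<in> {P, Y, ?Z}" for D
    proof -
      have "P \<subseteq> V - ?T" using PC(1) A_sub C_facts(1) by auto
      moreover have "Y \<subseteq> V - ?T" using Y(2) by auto
      moreover have "?Z \<subseteq> V - ?T"
        using D_facts(1,2)[OF Dxy(2)] aDy a1 xA xy(2) C_facts(1) by auto
      ultimately show ?thesis using that by blast
    qed
    show "connected_in E D" if "D \<in> {P, Y, ?Z}" for D using that PC Y Z by blast
    show "B \<inter> D = {}" if "B \<in> {P, Y, ?Z}" "D \<in> {P, Y, ?Z}" "B \<noteq> D" for B D
      using that d1 by (metis Int_commute empty_iff insert_iff)
    show "3 \<le> card ?T + card {P, Y, ?Z}" using cT by simp
  qed
  moreover have "(\<Sum>D\<in>{P, Y, ?Z}. card (nbr E D \<inter> ?T)) = 9"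
    using dist cT by (simp add: nP nZ nY)
  moreover have "card {P, Y, ?Z} = 3" using dist by simp
  ultimately show False using cT by simp
qed

text \<open>\<open>best\<close> says that b is good as soon as any vertex of A is. The part of R in
  Dx has neighbourhood A - {ay}, so ay is good and hence b is. A connected witness for b lies in Dx
  or Dy, which forces b to be ax or ay. An edge from x to ay would join the two components, and
  \<open>no_Dx_contact\<close> excludes ax.\<close>

lemma contradiction:
  assumes b: "b \<in> A" "{b, x} \<in> E"
    and best: "\<And>b' Y. b' \<in> A \<Longrightarrow> connected_in E Y \<Longrightarrow> Y \<subseteq> R \<Longrightarrow> nbr E Y = A - {b'} \<Longrightarrow>
      \<exists>Y. connected_in E Y \<and> Y \<subseteq> R \<and> nbr E Y = A - {b}"
  shows False
proof -
  obtain ax ay where a: "Dx \<inter> A = {ax}" "Dy \<inter> A = {ay}"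
    using tight(2,3) by (meson card_1_singletonE)
  have ne: "ax \<noteq> ay" "ax \<notin> T" "ay \<notin> T"
    using a Dxy(6) D_facts(2)[OF Dxy(1)] D_facts(2)[OF Dxy(2)] by auto
  have A: "A = (T \<inter> A) \<union> {ax, ay}" using A_eq a by auto
  obtain Y0 where Y0: "connected_in E Y0" "Y0 \<subseteq> Dx \<inter> R" "nbr E Y0 = (T \<inter> A) \<union> (Dx \<inter> A)"
    using R_component[of Dx] by auto
  have "nbr E Y0 = A - {ay}" using Y0(3) a ne A by auto
  moreover have "ay \<in> A" using a by auto
  ultimately obtain Y where Y: "connected_in E Y" "Y \<subseteq> R" "nbr E Y = A - {b}"
    using best[of ay Y0] Y0 by auto
  have YT: "Y \<subseteq> V - T" using Y(2) T_eq by auto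
  \<comment> \<open>The witness avoids C, so deleting {x, y} does not disconnect it.\<close>
  have "induced E Y = induced E' Y" using Y(2) xy by (auto simp: induced_def)
  then have "connected_in E' Y" using Y(1) by (simp add: connected_in_def)
  then obtain D where D: "D \<in> \<D>" "Y \<subseteq> D" using connected_in_comps YT by blast
  then have D': "D \<in> {Dx, Dy}" using D_eq by auto
  have YD: "Y \<subseteq> D \<inter> R" "nbr E Y \<inter> (D \<inter> R) = {}" using D(2) Y by auto
  have "A - {b} = (T \<inter> A) \<union> (D \<inter> A)"
    using R_component_nbr(1)[OF D' Y(1) YD] Y(3) by simp
  then have "b = ax \<or> b = ay" using D' a A b(1) ne by auto
  moreover have "b \<noteq> ay"
  proof
    assume "b = ay"
    then have "ay \<in> Dy" "ay \<notin> C" "{x, ay} \<in> E" using a A_sub b by (auto simp: insert_commute)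
    moreover have "{x, ay} \<noteq> {x, y}" using \<open>ay \<notin> C\<close> xy(3) by (auto simp: doubleton_eq_iff)
    ultimately have "ay \<in> Dx" using D_step[OF Dxy(1,3)] ne by blast
    then show False using \<open>ay \<in> Dy\<close> Dxy(6) by auto
  qed
  ultimately have "b = ax" by simp
  then show False using no_Dx_contact[of ax] a b(2) by (simp add: insert_commute)
qed

end

context high_degree_minimal
begin

lemma no_counterexample: False
proof -
  obtain C where C: "fragment C" "\<And>D. fragment D \<Longrightarrow> card C \<le> card D"
    by (rule obtain_minimal_fragment) (rule that)
  let ?A = "nbr E C"
  let ?good = "\<lambda>b. \<exists>Y. connected_in E Y \<and> Y \<subseteq> V - C - ?A \<and> nbr E Y = ?A - {b}"
  have A4: "card ?A = 4" using C by (simp add: fragment_def)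
  then have "?A \<noteq> {}" by auto
  \<comment> \<open>In the last remaining configuration the good vertices of \<open>?A\<close> are those outside \<open>T\<close>, so preferring
    a good \<open>b\<close> rules that configuration out.\<close>
  then obtain b where b: "b \<in> ?A" "\<And>b'. b' \<in> ?A \<Longrightarrow> ?good b' \<Longrightarrow> ?good b"
    by (cases "\<exists>b\<in>?A. ?good b") blast+
  obtain x where x: "x \<in> C" "{x, b} \<in> E" using b by (auto simp: nbr_def)
  have xV: "x \<in> V" using edgeD[OF x(2)] by simp
  \<comment> \<open>The degree assumption provides an edge at x inside C: the four vertices of A
    cannot hold all neighbours of x.\<close>
  have "\<not> nbr E {x} \<subseteq> ?A"
  proof
    assume "nbr E {x} \<subseteq> ?A"
    then have "card (nbr E {x}) \<le> 4" using card_mono[OF finite_nbr, of "nbr E {x}" C] A4 by simp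
    then show False using five[OF xV] by simp
  qed
  then obtain y where y: "{x, y} \<in> E" "y \<in> C" using x(1) by (auto simp: nbr_def)
  obtain T where T: "barrier {x, y} T" "\<And>S. barrier {x, y} S \<Longrightarrow> card T \<le> card S"
    by (rule obtain_minimal_barrier[OF y(1)]) (rule that)
  interpret crossing V E C x y T
    by unfold_locales (use C x y T in auto)
  show False
  proof (rule contradiction[OF b(1)])
    show "{b, x} \<in> E" using x(2) by (simp add: insert_commute)
    show "?good b" if "b' \<in> ?A" "connected_in E Y" "Y \<subseteq> R" "nbr E Y = ?A - {b'}" for b' Y
      using b(2)[OF that(1)] that(2-4) by blast
  qed
qed

end

theorem theorem3p3:
  fixes V :: "'a set" and E :: "'a set set"
  assumes "simple_graph V E"
    and "minimal_factor_critical 3 V E"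
    and "planar V E"
  shows "min_degree V E = 4"
proof -
  interpret planar_critical V E
    using assms by unfold_locales (auto simp: minimal_factor_critical_def)
  have V: "finite V" "V \<noteq> {}" using finite_V large by auto
  have deg: "degree E v = card (nbr E {v})" for v using degree_eq_card_nbr[OF graph] .
  have ge: "4 \<le> degree E v" if "v \<in> V" for v using degree_ge[OF that] deg by simp
  have "\<exists>v\<in>V. degree E v = 4"
  proof (rule ccontr)
    assume no: "\<not> ?thesis"
    have "5 \<le> card (nbr E {v})" if "v \<in> V" for v
      using ge[OF that] no that deg[of v] by (metis Suc_leI eval_nat_numeral(3) le_neq_implies_less)
    then interpret high_degree_minimal V E
      using assms(2) by unfold_locales (auto simp: minimal_factor_critical_def)
    show False by (rule no_counterexample)
  qed
  then obtain v where v: "v \<in> V" "degree E v = 4" by blast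
  show ?thesis
    unfolding min_degree_def
  proof (rule Min_eqI)
    show "finite (degree E ` V)" using V by simp
    show "4 \<le> d" if "d \<in> degree E ` V" for d using that ge by auto
    show "4 \<in> degree E ` V" using v by force
  qed
qed

end
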